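(* Let $(H,\delta)$ be a Fredholm chain, and for each $p\in\mathbb{Z}$ let $k_p\colon H_p\to H_{p-1}$ be a compact operator. Consider the sequence of spaces and maps $(H,\delta')$, where $\delta'_p=\delta_p+k_p$ for $p\in\mathbb{Z}$, and suppose that $R(\delta'_p\delta'_{p+1})$ is finite dimensional for each $p\in\mathbb{Z}$. Then $(H,\delta')$ is a Fredholm chain. Furthermore, $\operatorname{ind}(H,\delta)=\operatorname{ind}(H,\delta')$.
   Context: $L(X,Y)$ denotes the bounded linear maps between Hilbert spaces $X$ and $Y$; $N(\cdot)$ and $R(\cdot)$ denote null space and range. A sequence of spaces and maps $(H,\delta)$ consists of Hilbert spaces $H_p$ and operators $\delta_p\in L(H_p,H_{p-1})$, $p\in\mathbb{Z}$, for which there is $n\in\mathbb{N}$ such that $H_p=0$ and $\delta_p=0$ for $p<0$ and for $p\ge n+1$; i.e. $0\to H_n\xrightarrow{\delta_n}H_{n-1}\to\cdots\to H_1\xrightarrow{\delta_1}H_0\to 0$ (with no requirement that $\delta_p\delta_{p+1}=0$). It is called a Fredholm chain if $N(\delta_p)/(N(\delta_p)\cap R(\delta_{p+1}))$ and $R(\delta_{p+1})/(N(\delta_p)\cap R(\delta_{p+1}))$ are finite dimensional for every $p=0,\dots,n$. The index of a Fredholm chain is $\operatorname{ind}(H,\delta)=\sum_{p=0}^n(-1)^p\big(\dim N(\delta_p)/(N(\delta_p)\cap R(\delta_{p+1}))-\dim R(\delta_{p+1})/(N(\delta_p)\cap R(\delta_{p+1}))\big)$. *)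

theory Defs
  imports "HOL-Analysis.Analysis"
begin

text \<open>
  Scalars. The real numbers and the complex numbers are instances below; by the theorem of Mazur
  on real normed fields there are no others up to isomorphism, so the development covers real
  and complex Hilbert spaces at once.
\<close>

class hilbert_scalar = real_normed_field + heine_borel +
  fixes conj :: "'a \<Rightarrow> 'a"
  assumes conj_add: "conj (x + y) = conj x + conj y"
    and conj_mult_self: "conj x * x = (norm x)\<^sup>2 *\<^sub>R 1"

instantiation real :: hilbert_scalar
begin
definition conj_real :: "real \<Rightarrow> real" where "conj_real x = x"
instance by standard (simp_all add: conj_real_def power2_eq_square)
end

instantiation complex :: hilbert_scalar
begin
definition conj_complex :: "complex \<Rightarrow> complex" where "conj_complex x = cnj x"
instance
proof
  fix x y :: complex
  show "conj (x + y) = conj x + conj y" by (simp add: conj_complex_def)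
  show "conj x * x = (norm x)\<^sup>2 *\<^sub>R 1"
    unfolding conj_complex_def scaleR_conv_of_real complex_norm_square by (simp add: mult.commute)
qed
end

text \<open>
  A Hilbert space over the scalar field \<open>'k\<close>. Norm, topology and completeness are those of the
  type \<open>'a\<close>. The sort \<open>real_inner\<close> is no restriction: the norm of a Hilbert space over either field
  comes from a real inner product, namely the real part of \<open>ip\<close>.
\<close>

locale hilbert_space = vector_space scale
  for scale :: "'k::hilbert_scalar \<Rightarrow> 'a::{real_inner, complete_space} \<Rightarrow> 'a" +
  fixes ip :: "'a \<Rightarrow> 'a \<Rightarrow> 'k"
  assumes scale_of_real: "scale (of_real r) x = r *\<^sub>R x"
    and ip_add_left: "ip (x + y) z = ip x z + ip y z"
    and ip_scale_left: "ip (scale c x) y = c * ip x y"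
    and ip_conj: "ip y x = conj (ip x y)"
    and ip_self: "ip x x = of_real ((norm x)\<^sup>2)"

text \<open>
  The spaces of a sequence are closed subspaces of one Hilbert space \<open>'a\<close>. This is no restriction,
  since only finitely many of them are nonzero and so they all embed isometrically into their
  orthogonal direct sum. Operators are functions \<open>'a \<Rightarrow> 'a\<close> of which only the values
  on the domain subspace matter.
\<close>

context hilbert_space
begin

definition closed_subspace :: "'a set \<Rightarrow> bool" where
  "closed_subspace X \<longleftrightarrow> subspace X \<and> closed X"

definition bounded_op :: "'a set \<Rightarrow> 'a set \<Rightarrow> ('a \<Rightarrow> 'a) \<Rightarrow> bool" where
  "bounded_op X Y T \<longleftrightarrow>
     (\<forall>x\<in>X. T x \<in> Y) \<and>
     (\<forall>x\<in>X. \<forall>y\<in>X. T (x + y) = T x + T y) \<and>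
     (\<forall>c. \<forall>x\<in>X. T (scale c x) = scale c (T x)) \<and>
     (\<exists>K. \<forall>x\<in>X. norm (T x) \<le> K * norm x)"

definition compact_op :: "'a set \<Rightarrow> 'a set \<Rightarrow> ('a \<Rightarrow> 'a) \<Rightarrow> bool" where
  "compact_op X Y T \<longleftrightarrow> bounded_op X Y T \<and> compact (closure (T ` (X \<inter> cball 0 1)))"

definition finite_dim :: "'a set \<Rightarrow> bool" where
  "finite_dim V \<longleftrightarrow> (\<exists>B. finite B \<and> V \<subseteq> span B)"

text \<open>
  Quotient spaces are handled through representatives: \<open>quot_basis V W B\<close> says that the
  classes \<open>b + W\<close>, for \<open>b\<close> in the finite set \<open>B\<close>, are pairwise distinct and form a basis of \<open>V / W\<close>.
\<close>

definition quot_basis :: "'a set \<Rightarrow> 'a set \<Rightarrow> 'a set \<Rightarrow> bool" where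
  "quot_basis V W B \<longleftrightarrow>
     finite B \<and> B \<subseteq> V \<and>
     (\<forall>v\<in>V. \<exists>a. v - (\<Sum>b\<in>B. scale (a b) b) \<in> W) \<and>
     (\<forall>a. (\<Sum>b\<in>B. scale (a b) b) \<in> W \<longrightarrow> (\<forall>b\<in>B. a b = 0))"

definition quot_finite_dim :: "'a set \<Rightarrow> 'a set \<Rightarrow> bool" where
  "quot_finite_dim V W \<longleftrightarrow> (\<exists>B. quot_basis V W B)"

definition quot_dim :: "'a set \<Rightarrow> 'a set \<Rightarrow> nat" where
  "quot_dim V W = (THE d. \<exists>B. quot_basis V W B \<and> card B = d)"

lemma quot_basis_card_le:
  assumes W: "subspace W" and B: "quot_basis V W B" and C: "quot_basis V W C"
  shows "card B \<le> card C"
proof -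
  have "B \<subseteq> V" and "\<forall>v\<in>V. \<exists>a. v - (\<Sum>c\<in>C. scale (a c) c) \<in> W"
    using B C by (simp_all add: quot_basis_def)
  then have "\<forall>b\<in>B. \<exists>a. b - (\<Sum>c\<in>C. scale (a c) c) \<in> W" by (meson subsetD)
  from bchoice[OF this]
  obtain a where a: "\<forall>b\<in>B. b - (\<Sum>c\<in>C. scale (a b c) c) \<in> W" ..
  define u where "u b = (\<Sum>c\<in>C. scale (a b c) c)" for b
  have fin: "finite B" "finite C" using B C by (auto simp: quot_basis_def)
  have key: "\<forall>b\<in>B. r b = 0" if "(\<Sum>b\<in>B. scale (r b) (u b)) = 0" for r
  proof -
    have "(\<Sum>b\<in>B. scale (r b) (b - u b)) \<in> W"
      by (intro subspace_sum[OF W] subspace_scale[OF W]) (use a in \<open>auto simp: u_def\<close>)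
    then have "(\<Sum>b\<in>B. scale (r b) b) \<in> W"
      using that by (simp add: scale_right_diff_distrib sum_subtractf)
    then show ?thesis using B by (simp add: quot_basis_def)
  qed
  have inj: "inj_on u B"
  proof (rule inj_onI, rule ccontr)
    fix x y assume xy: "x \<in> B" "y \<in> B" "u x = u y" "x \<noteq> y"
    define r :: "'a \<Rightarrow> 'k" where "r b = (if b = x then 1 else if b = y then -1 else 0)" for b
    have "(\<Sum>b\<in>B. scale (r b) (u b)) = (\<Sum>b\<in>{x,y}. scale (r b) (u b))"
      by (rule sum.mono_neutral_right) (use xy fin in \<open>auto simp: r_def\<close>)
    also have "\<dots> = 0" using xy by (simp add: r_def)
    finally have "r x = 0" using key xy by blast
    then show False by (simp add: r_def)
  qed
  have "independent (u ` B)"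
  proof (rule independent_if_scalars_zero)
    show "finite (u ` B)" using fin by simp
    fix f x assume "(\<Sum>x\<in>u ` B. scale (f x) x) = 0" and x: "x \<in> u ` B"
    then have "(\<Sum>b\<in>B. scale (f (u b)) (u b)) = 0"
      using inj by (simp add: sum.reindex)
    then have "\<forall>b\<in>B. f (u b) = 0" by (rule key)
    then show "f x = 0" using x by blast
  qed
  moreover have "u ` B \<subseteq> span C"
    unfolding u_def by (blast intro: span_sum span_scale span_base)
  ultimately have "card (u ` B) \<le> card C"
    using independent_span_bound[OF fin(2)] by blast
  then show ?thesis using inj by (simp add: card_image)
qed

lemma quot_dim_eq_card:
  assumes "subspace W" and "quot_basis V W B"
  shows "quot_dim V W = card B"
  unfolding quot_dim_def
proof (rule the_equality)
  show "\<exists>C. quot_basis V W C \<and> card C = card B" using assms(2) by blast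
next
  fix d assume "\<exists>C. quot_basis V W C \<and> card C = d"
  then obtain C where C: "quot_basis V W C" "card C = d" by blast
  show "d = card B"
    using quot_basis_card_le[OF assms(1) assms(2) C(1)] quot_basis_card_le[OF assms(1) C(1) assms(2)] C(2)
    by simp
qed

definition null_space :: "(int \<Rightarrow> 'a set) \<Rightarrow> (int \<Rightarrow> 'a \<Rightarrow> 'a) \<Rightarrow> int \<Rightarrow> 'a set" where
  "null_space H \<delta> p = {x \<in> H p. \<delta> p x = 0}"

definition range_space :: "(int \<Rightarrow> 'a set) \<Rightarrow> (int \<Rightarrow> 'a \<Rightarrow> 'a) \<Rightarrow> int \<Rightarrow> 'a set" where
  "range_space H \<delta> p = \<delta> p ` H p"

text \<open>
  The length bound \<open>n\<close> is kept as an explicit parameter. Neither \<open>fredholm_chain\<close> nor \<open>chain_index\<close>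
  depends on its choice, because all spaces in degrees above an admissible \<open>n\<close> vanish.
\<close>

definition spaces_and_maps :: "nat \<Rightarrow> (int \<Rightarrow> 'a set) \<Rightarrow> (int \<Rightarrow> 'a \<Rightarrow> 'a) \<Rightarrow> bool" where
  "spaces_and_maps n H \<delta> \<longleftrightarrow>
     (\<forall>p. closed_subspace (H p)) \<and>
     (\<forall>p. bounded_op (H p) (H (p - 1)) (\<delta> p)) \<and>
     (\<forall>p. p < 0 \<or> p \<ge> int n + 1 \<longrightarrow> H p = {0} \<and> (\<forall>x\<in>H p. \<delta> p x = 0))"

definition fredholm_chain :: "nat \<Rightarrow> (int \<Rightarrow> 'a set) \<Rightarrow> (int \<Rightarrow> 'a \<Rightarrow> 'a) \<Rightarrow> bool" where
  "fredholm_chain n H \<delta> \<longleftrightarrow>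
     spaces_and_maps n H \<delta> \<and>
     (\<forall>p\<in>{0..int n}.
        quot_finite_dim (null_space H \<delta> p) (null_space H \<delta> p \<inter> range_space H \<delta> (p + 1)) \<and>
        quot_finite_dim (range_space H \<delta> (p + 1)) (null_space H \<delta> p \<inter> range_space H \<delta> (p + 1)))"

definition chain_index :: "nat \<Rightarrow> (int \<Rightarrow> 'a set) \<Rightarrow> (int \<Rightarrow> 'a \<Rightarrow> 'a) \<Rightarrow> int" where
  "chain_index n H \<delta> =
     (\<Sum>p\<in>{0..int n}. (-1) ^ nat p *
        (int (quot_dim (null_space H \<delta> p) (null_space H \<delta> p \<inter> range_space H \<delta> (p + 1))) -
         int (quot_dim (range_space H \<delta> (p + 1)) (null_space H \<delta> p \<inter> range_space H \<delta> (p + 1)))))"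

end

end

theory Submission
  imports Defs
begin

text \<open>
  Write \<open>N\<^sub>p\<close> and \<open>R\<^sub>p\<close> for the null space and the range of \<open>\<delta>\<^sub>p\<close>, and \<open>M\<^sub>p\<close> for the orthogonal
  complement of \<open>N\<^sub>p\<close> in \<open>H\<^sub>p\<close>; primes refer to \<open>\<delta>'\<close>. Instead of forming one operator on the direct
  sum of all the spaces, the proof works with the \<^emph>\<open>reduced maps\<close> \<open>D\<^sub>p : M\<^sub>p \<rightarrow> N\<^sub>p\<^sub>-\<^sub>1\<close>, that is, \<open>\<delta>\<^sub>p\<close>
  restricted to \<open>M\<^sub>p\<close> and followed by the orthogonal projection onto \<open>N\<^sub>p\<^sub>-\<^sub>1\<close>. For a Fredholm chain each
  \<open>D\<^sub>p\<close> is a Fredholm operator, its index \<open>i\<^sub>p\<close> is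
  \<open>dim R\<^sub>p / (N\<^sub>p\<^sub>-\<^sub>1 \<inter> R\<^sub>p) - dim N\<^sub>p\<^sub>-\<^sub>1 / (N\<^sub>p\<^sub>-\<^sub>1 \<inter> R\<^sub>p)\<close>, and so the index of the chain is
  \<open>- (\<Sum>p. (-1) ^ p * i\<^sub>p\<^sub>+\<^sub>1)\<close> (\<open>fredholm_index_reduced_map\<close>, \<open>chain_index_reduced_index\<close>).

  \<^emph>\<open>The null spaces of \<open>\<delta>\<close> and \<open>\<delta>'\<close> are compactly close.\<close> If \<open>z\<close> lies in \<open>N'\<^sub>p\<close>, its component \<open>w\<close> in
  \<open>M\<^sub>p\<close> satisfies \<open>\<delta>\<^sub>p w = - k\<^sub>p z\<close>; a bounded inverse of \<open>D\<^sub>p\<close> up to finite rank recovers \<open>w\<close> from this, so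
  \<open>w\<close> depends compactly on \<open>z\<close> (\<open>null_space_perturbation\<close>). The bounded inverse comes from the open
  mapping theorem (\<open>open_mapping_estimate\<close>, \<open>fredholm_parametrix\<close>).

  \<^emph>\<open>\<open>\<delta>'\<close> is Fredholm.\<close> Let \<open>E\<close> be such an inverse of \<open>D\<^sub>p\<close>. For \<open>z\<close> in \<open>N'\<^sub>p\<^sub>-\<^sub>1\<close> the vector
  \<open>\<delta>'\<^sub>p E P z\<close>, where \<open>P\<close> is the projection onto \<open>N\<^sub>p\<^sub>-\<^sub>1\<close>, differs from \<open>z\<close> by a compact operator of \<open>z\<close>, and
  it lies in \<open>N'\<^sub>p\<^sub>-\<^sub>1\<close> for all \<open>z\<close> in a subspace of finite codimension because \<open>\<delta>'\<^sub>p\<^sub>-\<^sub>1 \<delta>'\<^sub>p\<close> has finite rank.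
  The identity plus a compact operator maps such a subspace onto one of finite codimension, so
  \<open>N'\<^sub>p\<^sub>-\<^sub>1 \<inter> R'\<^sub>p\<close> has finite codimension in \<open>N'\<^sub>p\<^sub>-\<^sub>1\<close>. Its codimension in \<open>R'\<^sub>p\<close> is the rank of
  \<open>\<delta>'\<^sub>p\<^sub>-\<^sub>1 \<delta>'\<^sub>p\<close> (\<open>fredholm_perturbation\<close>).

  \<^emph>\<open>The indices agree.\<close> Let \<open>a\<^sub>p\<close> be the index of the orthogonal projection \<open>N\<^sub>p \<rightarrow> N'\<^sub>p\<close>. The projection
  \<open>M\<^sub>p \<rightarrow> M'\<^sub>p\<close> then has index \<open>- a\<^sub>p\<close>, because together the two are the diagonal of an operator on \<open>H\<^sub>p\<close>
  that is triangular and a compact perturbation of the identity (\<open>projection_index\<close>). The square formed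
  by \<open>D\<^sub>p\<close>, \<open>D'\<^sub>p\<close> and the projections commutes up to a compact operator, hence
  \<open>i\<^sub>p + a\<^sub>p\<^sub>-\<^sub>1 = i'\<^sub>p - a\<^sub>p\<close> (\<open>reduced_map_index_difference\<close>). In the alternating sum the numbers \<open>a\<^sub>p\<close>
  telescope to \<open>a\<^sub>0\<close> and \<open>a\<^sub>n\<^sub>+\<^sub>1\<close>, which vanish since \<open>N\<^sub>0 = H\<^sub>0 = N'\<^sub>0\<close> and \<open>H\<^sub>n\<^sub>+\<^sub>1 = 0\<close>.

  Two choices keep the operator theory short. A Fredholm operator is described by a subspace of
  finite codimension on which it is injective with image of finite codimension; this makes the
  index independent of choices and additive under composition by counting codimensions. Compact
  operators enter only through their approximation in norm by operators of finite rank, which gives the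
  vanishing index of \<open>1 + K\<close> at once: after removing an operator of finite rank only a
  contraction is added to the identity (\<open>fredholm_index_id_plus\<close>).
\<close>

section \<open>Complete inner product spaces and normed spaces\<close>

text \<open>
  By the parallelogram law a minimizing sequence for the distance is a Cauchy sequence: midpoints of
  points of \<open>V\<close> stay in \<open>V\<close> and cannot be closer to \<open>x\<close> than the infimum.
\<close>

lemma closed_subspace_nearest_point:
  fixes V :: "'b::{real_inner, complete_space} set"
  assumes V: "subspace V" "closed V"
  shows "\<exists>p\<in>V. \<forall>v\<in>V. norm (x - p) \<le> norm (x - v)"
proof -
  define D where "D = (INF v\<in>V. (norm (x - v))\<^sup>2)"
  have ne: "V \<noteq> {}" using subspace_0[OF V(1)] by auto
  have bdd: "bdd_below ((\<lambda>v. (norm (x - v))\<^sup>2) ` V)" by (rule bdd_belowI[of _ 0]) auto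
  have D: "D \<le> (norm (x - v))\<^sup>2" if "v \<in> V" for v
    unfolding D_def by (rule cINF_lower[OF bdd that])
  have "\<exists>v\<in>V. (norm (x - v))\<^sup>2 < D + 1 / Suc n" for n
    using cINF_less_iff[OF ne bdd, of "D + 1 / Suc n"] unfolding D_def by simp
  then obtain v where v: "\<And>n. v n \<in> V" "\<And>n. (norm (x - v n))\<^sup>2 < D + 1 / Suc n" by metis
  \<comment> \<open>the parallelogram law for \<open>x - v m\<close> and \<open>x - v n\<close>\<close>
  have par: "(dist (v m) (v n))\<^sup>2 \<le> 2 / Suc m + 2 / Suc n" for m n
  proof -
    have "(1/2) *\<^sub>R (v m + v n) \<in> V" by (intro subspace_scale subspace_add V v)
    then have "D \<le> (norm (x - (1/2) *\<^sub>R (v m + v n)))\<^sup>2" by (rule D)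
    moreover have "(dist (v m) (v n))\<^sup>2 = 2 * (norm (x - v m))\<^sup>2 + 2 * (norm (x - v n))\<^sup>2
       - 4 * (norm (x - (1/2) *\<^sub>R (v m + v n)))\<^sup>2"
      unfolding dist_norm power2_norm_eq_inner
      by (simp add: inner_diff_left inner_diff_right inner_add_left inner_add_right inner_commute algebra_simps)
    ultimately show ?thesis using v(2)[of m] v(2)[of n] by simp
  qed
  have "Cauchy v"
  proof (rule metric_CauchyI)
    fix e :: real assume e: "e > 0"
    obtain N :: nat where N: "4 / e\<^sup>2 < real N" using reals_Archimedean2 by blast
    have "dist (v m) (v n) < e" if "m \<ge> N" "n \<ge> N" for m n
    proof -
      have le: "2 / Suc k \<le> 2 / Suc N" if "k \<ge> N" for k using that by (intro divide_left_mono) auto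
      have "(dist (v m) (v n))\<^sup>2 \<le> 2 / Suc N + 2 / Suc N" using par[of m n] le[OF that(1)] le[OF that(2)] by linarith
      also have "\<dots> = 4 / Suc N" by simp
      also have "\<dots> < e\<^sup>2"
      proof -
        have "4 < real N * e\<^sup>2" using N e by (simp add: field_simps)
        also have "\<dots> \<le> real (Suc N) * e\<^sup>2" using e by (intro mult_right_mono) auto
        finally show ?thesis by (simp add: field_simps)
      qed
      finally show ?thesis using e by (simp add: power2_less_imp_less)
    qed
    then show "\<exists>M. \<forall>m\<ge>M. \<forall>n\<ge>M. dist (v m) (v n) < e" by blast
  qed
  then obtain p where p: "v \<longlonglongrightarrow> p" using Cauchy_convergent convergent_def by blast
  have pV: "p \<in> V" using closed_sequentially[OF V(2) v(1) p] .
  have l1: "(\<lambda>n. D + 1 / Suc n) \<longlonglongrightarrow> D + 0"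
    by (intro tendsto_intros) (rule LIMSEQ_Suc[OF lim_1_over_n])
  have l2: "(\<lambda>n. (norm (x - v n))\<^sup>2) \<longlonglongrightarrow> (norm (x - p))\<^sup>2" by (intro tendsto_intros p)
  have "(norm (x - v n))\<^sup>2 \<le> D + 1 / Suc n" for n using v(2)[of n] by (rule less_imp_le)
  then have pD: "(norm (x - p))\<^sup>2 \<le> D" using LIMSEQ_le[OF l2 l1] by (metis add.right_neutral)
  have "norm (x - p) \<le> norm (x - v)" if "v \<in> V" for v
    by (rule power2_le_imp_le) (use order.trans[OF pD D[OF that]] in auto)
  then show ?thesis using pV by blast
qed

text \<open>
  The error of a nearest point is orthogonal to \<open>V\<close>, since moving the point along \<open>v\<close> by the
  multiple that removes the component of the error in direction \<open>v\<close> would otherwise shorten it.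
\<close>

lemma closed_subspace_orthogonal_decomposition:
  fixes V :: "'b::{real_inner, complete_space} set"
  assumes V: "subspace V" "closed V"
  shows "\<exists>p\<in>V. \<forall>v\<in>V. inner (x - p) v = 0"
proof -
  obtain p where p: "p \<in> V" "\<And>v. v \<in> V \<Longrightarrow> norm (x - p) \<le> norm (x - v)"
    using closed_subspace_nearest_point[OF V] by blast
  have "inner (x - p) v = 0" if v: "v \<in> V" for v
  proof (cases "v = 0")
    case False
    \<comment> \<open>the multiple of \<open>v\<close> by which \<open>p\<close> would have to be corrected\<close>
    define t where "t = inner (x - p) v / inner v v"
    have "p + t *\<^sub>R v \<in> V" by (intro subspace_scale subspace_add V v p)
    from p(2)[OF this] have "(norm (x - p))\<^sup>2 \<le> (norm (x - p - t *\<^sub>R v))\<^sup>2"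
      by (intro power_mono) (auto simp: diff_diff_add)
    also have "\<dots> = (norm (x - p))\<^sup>2 - 2 * t * inner (x - p) v + t * t * inner v v"
      unfolding power2_norm_eq_inner inner_diff_left[of "x - p"] inner_diff_right[of _ "x - p"]
      using inner_commute[of v p] inner_commute[of v x] by (simp add: algebra_simps)
    also have "t * t * inner v v = t * inner (x - p) v" using False by (simp add: t_def)
    finally have "t * inner (x - p) v \<le> 0" by simp
    then have "(inner (x - p) v)\<^sup>2 / inner v v \<le> 0" by (simp add: t_def power2_eq_square)
    moreover have "inner v v > 0" using False by simp
    ultimately show ?thesis by (simp add: divide_le_0_iff)
  qed simp
  then show ?thesis using p by blast
qed

text \<open>
  The open mapping theorem in quantitative form. By Baire's theorem the closure of the image
  of some ball contains a ball of \<open>Y\<close>; by symmetry and convexity it may be centred at 0. So every \<open>y\<close> is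
  approximated with error at most \<open>norm y / 2\<close> by the image of a vector of norm at most \<open>c * norm y\<close>,
  and iterating this on the errors gives a convergent series of preimages.
\<close>

lemma open_mapping_estimate:
  fixes f :: "'b::{real_normed_vector, complete_space} \<Rightarrow> 'c::{real_normed_vector, complete_space}"
  assumes f: "bounded_linear f" and X: "subspace X" "closed X" and Y: "subspace Y" "closed Y"
    and fX: "f ` X = Y"
  shows "\<exists>C. \<forall>y\<in>Y. \<exists>x\<in>X. f x = y \<and> norm x \<le> C * norm y"
proof -
  interpret f: bounded_linear f by fact
  define A where "A n = f ` (X \<inter> cball 0 (real n))" for n
  have AY: "closure (A n) \<subseteq> Y" for n
    by (rule closure_minimal) (use fX Y in \<open>auto simp: A_def\<close>)
  have un: "(\<Union>n. closure (A n)) = Y"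
  proof
    show "(\<Union>n. closure (A n)) \<subseteq> Y" using AY by blast
    show "Y \<subseteq> (\<Union>n. closure (A n))"
    proof
      fix y assume "y \<in> Y"
      then obtain x where x: "x \<in> X" "y = f x" using fX by auto
      obtain n :: nat where "norm x \<le> real n" using real_arch_simple by blast
      then have "y \<in> A n" using x by (auto simp: A_def)
      then show "y \<in> (\<Union>n. closure (A n))" using closure_subset by blast
    qed
  qed
  have Y0: "0 \<in> Y" using subspace_0[OF Y(1)] .
  have "\<exists>n. top_of_set Y interior_of closure (A n) \<noteq> {}"
  proof (rule ccontr)
    assume neg: "\<nexists>n. top_of_set Y interior_of closure (A n) \<noteq> {}"
    have "top_of_set Y interior_of \<Union>(range (\<lambda>n. closure (A n))) = {}"
    proof (rule Baire_category_alt)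
      show "completely_metrizable_space (top_of_set Y) \<or> locally_compact_space (top_of_set Y) \<and> regular_space (top_of_set Y)"
        using completely_metrizable_space_closedin[OF completely_metrizable_space_euclidean] Y(2) by auto
      fix T assume "T \<in> range (\<lambda>n. closure (A n))"
      then show "closedin (top_of_set Y) T \<and> top_of_set Y interior_of T = {}"
        using neg AY by (auto intro!: closed_subset)
    qed auto
    then have "top_of_set Y interior_of Y = {}" using un by simp
    moreover have "top_of_set Y interior_of Y = Y" using interior_of_topspace[of "top_of_set Y"] by simp
    ultimately show False using Y0 by auto
  qed
  then obtain n y0 where "y0 \<in> top_of_set Y interior_of closure (A n)" by blast
  then obtain T where T: "openin (top_of_set Y) T" "y0 \<in> T" "T \<subseteq> closure (A n)"
    by (auto simp: interior_of_def)
  then obtain e where e: "e > 0" "ball y0 e \<inter> Y \<subseteq> T" and y0: "y0 \<in> Y"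
    by (metis openin_contains_ball openin_imp_subset subsetD)
  have near: "\<exists>x\<in>X. norm x \<le> real n \<and> norm (y - f x) < \<epsilon>" if y: "y \<in> Y" "norm y < e" and eps: "\<epsilon> > 0" for y \<epsilon>
  proof -
    \<comment> \<open>\<open>y\<close> is half the difference of two points near \<open>y0\<close>, which moves the centre to 0\<close>
    have "y0 + y \<in> ball y0 e \<inter> Y" "y0 - y \<in> ball y0 e \<inter> Y"
      using y y0 Y by (auto simp: dist_norm intro: subspace_add subspace_diff)
    then have "y0 + y \<in> closure (A n)" "y0 - y \<in> closure (A n)" using e T by blast+
    then obtain a b where "a \<in> A n" "dist a (y0 + y) < \<epsilon>" and "b \<in> A n" "dist b (y0 - y) < \<epsilon>"
      using eps unfolding closure_approachable by metis
    then obtain u v where u: "u \<in> X" "norm u \<le> real n" "norm (f u - (y0 + y)) < \<epsilon>"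
      and v: "v \<in> X" "norm v \<le> real n" "norm (f v - (y0 - y)) < \<epsilon>"
      by (auto simp: A_def dist_norm)
    define x where "x = (1/2) *\<^sub>R (u - v)"
    have "x \<in> X" unfolding x_def by (intro subspace_scale subspace_diff X u v)
    moreover have "norm x \<le> real n" unfolding x_def using norm_triangle_ineq4[of u v] u v by simp
    moreover have "norm (y - f x) < \<epsilon>"
    proof -
      have "y - f x = (1/2) *\<^sub>R ((f v - (y0 - y)) - (f u - (y0 + y)))"
        unfolding x_def f.scaleR f.diff by (simp add: algebra_simps flip: scaleR_add_left)
      then have "norm (y - f x) = (1/2) * norm ((f v - (y0 - y)) - (f u - (y0 + y)))" by simp
      also have "\<dots> \<le> (1/2) * (norm (f v - (y0 - y)) + norm (f u - (y0 + y)))"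
        by (intro mult_left_mono norm_triangle_ineq4) auto
      also have "\<dots> < \<epsilon>" using u v by simp
      finally show ?thesis .
    qed
    ultimately show ?thesis by blast
  qed
  define c where "c = 2 * real n / e"
  have c0: "c \<ge> 0" using e by (simp add: c_def)
  have "\<exists>x\<in>X. norm x \<le> c * norm y \<and> norm (y - f x) \<le> norm y / 2" if y: "y \<in> Y" for y
  proof (cases "y = 0")
    case True then show ?thesis using subspace_0[OF X(1)] by (auto simp: f.zero)
  next
    case False
    define t where "t = e / (2 * norm y)"
    have t: "t > 0" using False e by (simp add: t_def)
    have "norm (t *\<^sub>R y) < e" using False e by (simp add: t_def)
    moreover have "t *\<^sub>R y \<in> Y" by (intro subspace_scale Y y)
    ultimately obtain x where x: "x \<in> X" "norm x \<le> real n" "norm (t *\<^sub>R y - f x) < e / 4"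
      using near[of "t *\<^sub>R y" "e/4"] e by auto
    have "norm ((1/t) *\<^sub>R x) = norm x / t" using t by simp
    also have "\<dots> \<le> real n / t" using x t by (simp add: divide_right_mono)
    also have "\<dots> = c * norm y" using e by (simp add: t_def c_def)
    finally have 1: "norm ((1/t) *\<^sub>R x) \<le> c * norm y" .
    have "y - f ((1/t) *\<^sub>R x) = (1/t) *\<^sub>R (t *\<^sub>R y - f x)"
      using t by (simp add: f.scaleR scaleR_diff_right)
    then have "norm (y - f ((1/t) *\<^sub>R x)) = norm (t *\<^sub>R y - f x) / t" using t by simp
    also have "\<dots> \<le> (e / 4) / t" using x t by (intro divide_right_mono) auto
    also have "\<dots> = norm y / 2" using e by (simp add: t_def)
    finally show ?thesis using 1 x X(1) by (auto intro!: bexI[of _ "(1/t) *\<^sub>R x"] subspace_scale)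
  qed
  then obtain g where g: "\<And>y. y \<in> Y \<Longrightarrow> g y \<in> X" "\<And>y. y \<in> Y \<Longrightarrow> norm (g y) \<le> c * norm y"
    "\<And>y. y \<in> Y \<Longrightarrow> norm (y - f (g y)) \<le> norm y / 2" by metis
  have "\<exists>x\<in>X. f x = y \<and> norm x \<le> (2 * c) * norm y" if y: "y \<in> Y" for y
  proof -
    \<comment> \<open>the error left after \<open>k\<close> corrections, at most \<open>norm y / 2 ^ k\<close>\<close>
    define r where "r k = ((\<lambda>z. z - f (g z)) ^^ k) y" for k
    have rS: "r (Suc k) = r k - f (g (r k))" for k by (simp add: r_def)
    have rY: "r k \<in> Y" for k
    proof (induction k)
      case (Suc k) then show ?case unfolding rS using g(1) fX Y(1) by (auto intro!: subspace_diff)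
    qed (use y in \<open>simp add: r_def\<close>)
    have rn: "norm (r k) \<le> norm y * (1/2) ^ k" for k
    proof (induction k)
      case (Suc k) then show ?case using g(3)[OF rY[of k]] by (simp add: rS)
    qed (simp add: r_def)
    define s where "s k = c * norm y * (1/2) ^ k" for k :: nat
    have gn: "norm (g (r k)) \<le> s k" for k
      using g(2)[OF rY[of k]] mult_left_mono[OF rn[of k] c0] by (simp add: s_def mult.assoc)
    have "(\<lambda>k::nat. (1/2::real) ^ k) sums 2" using geometric_sums[of "1/2::real"] by simp
    from sums_mult[OF this, of "c * norm y"] have ss: "s sums (2 * c * norm y)"
      unfolding s_def by (simp add: mult_ac)
    define \<sigma> where "\<sigma> n = (\<Sum>k<n. g (r k))" for n
    define S where "S n = (\<Sum>k<n. s k)" for n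
    have SL: "S \<longlonglongrightarrow> 2 * c * norm y" using ss unfolding sums_def S_def[abs_def] .
    have le: "norm (\<sigma> n - \<sigma> m) \<le> S n - S m" if "m \<le> n" for m n
      using that
    proof (induction n rule: dec_induct)
      case (step n)
      have "\<sigma> (Suc n) - \<sigma> m = (\<sigma> n - \<sigma> m) + g (r n)" by (simp add: \<sigma>_def)
      then have "norm (\<sigma> (Suc n) - \<sigma> m) \<le> norm (\<sigma> n - \<sigma> m) + norm (g (r n))"
        using norm_triangle_ineq by metis
      then show ?case using step.IH gn[of n] by (simp add: S_def)
    qed simp
    have dle: "dist (\<sigma> m) (\<sigma> n) \<le> dist (S m) (S n)" for m n
      using le[of m n] le[of n m] nat_le_linear[of m n] by (auto simp: dist_norm norm_minus_commute)
    have "Cauchy S" using SL by (rule LIMSEQ_imp_Cauchy)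
    then have "Cauchy \<sigma>" unfolding Cauchy_def using dle by (meson le_less_trans)
    then obtain x where x: "\<sigma> \<longlonglongrightarrow> x" using Cauchy_convergent convergent_def by blast
    have "x \<in> X"
    proof (rule closed_sequentially[OF X(2) _ x])
      show "\<sigma> n \<in> X" for n unfolding \<sigma>_def by (intro subspace_sum X g rY)
    qed
    moreover have "f x = y"
    proof -
      have "(\<lambda>k. norm y * (1/2) ^ k) \<longlonglongrightarrow> norm y * 0" by (intro tendsto_intros) auto
      then have "(\<lambda>k. norm y * (1/2) ^ k) \<longlonglongrightarrow> 0" by simp
      then have "r \<longlonglongrightarrow> 0" by (rule Lim_null_comparison[rotated]) (use rn in auto)
      then have "(\<lambda>n. y - r n) \<longlonglongrightarrow> y - 0" by (intro tendsto_intros)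
      moreover have "f (\<sigma> n) = y - r n" for n
        by (induction n) (simp_all add: \<sigma>_def f.zero f.add rS, simp add: r_def)
      ultimately have "(\<lambda>n. f (\<sigma> n)) \<longlonglongrightarrow> y" by simp
      moreover have "(\<lambda>n. f (\<sigma> n)) \<longlonglongrightarrow> f x" by (rule f.tendsto[OF x])
      ultimately show ?thesis using LIMSEQ_unique by blast
    qed
    moreover have "norm x \<le> 2 * c * norm y"
    proof (rule LIMSEQ_le[OF tendsto_norm[OF x] SL])
      have "norm (\<sigma> n) \<le> S n" for n using le[of 0 n] by (simp add: \<sigma>_def S_def)
      then show "\<exists>N. \<forall>n\<ge>N. norm (\<sigma> n) \<le> S n" by blast
    qed
    ultimately show ?thesis by blast
  qed
  then show ?thesis by blast
qed

context hilbert_space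
begin

section \<open>Subspaces of finite codimension\<close>

abbreviation lin :: "('a \<Rightarrow> 'a) \<Rightarrow> bool" where
  "lin \<equiv> module_hom scale scale"

text \<open>
  Codimension as a relation: it carries finiteness along with the value, and it holds only
  for nested subspaces, so that rules about it need no separate side conditions.
\<close>

definition has_codim :: "'a set \<Rightarrow> 'a set \<Rightarrow> nat \<Rightarrow> bool" where
  "has_codim V W n \<longleftrightarrow> subspace V \<and> subspace W \<and> W \<subseteq> V \<and> (\<exists>B. quot_basis V W B \<and> card B = n)"

lemma has_codim_subspace:
  assumes "has_codim V W n" shows "subspace V" "subspace W" "W \<subseteq> V"
  using assms by (auto simp: has_codim_def)

lemma quot_finite_dim_has_codim:
  assumes "subspace V" "subspace W" "W \<subseteq> V"
  shows "quot_finite_dim V W \<longleftrightarrow> (\<exists>n. has_codim V W n)"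
  using assms by (auto simp: has_codim_def quot_finite_dim_def)

lemma has_codim_quot_dim: "has_codim V W n \<Longrightarrow> quot_dim V W = n"
  unfolding has_codim_def using quot_dim_eq_card by blast

lemma has_codim_unique: "has_codim V W m \<Longrightarrow> has_codim V W n \<Longrightarrow> m = n"
  using has_codim_quot_dim by blast

lemma has_codim_refl: "subspace V \<Longrightarrow> has_codim V V 0"
  unfolding has_codim_def quot_basis_def by (auto intro!: exI[of _ "{}"])

lemma quot_basis_coeff_0:
  assumes "quot_basis V W B" "(\<Sum>b\<in>B. scale (a b) b) \<in> W" "b \<in> B" shows "a b = 0"
  using assms by (simp add: quot_basis_def)

text \<open>
  Enlarging \<open>V\<close> by one dimension, spanned by \<open>u\<close>, enlarges a basis of \<open>V / W\<close> by \<open>u\<close>.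
\<close>

lemma quot_basis_insert:
  assumes V: "subspace V" and W: "subspace W"
    and C: "quot_basis V W C" and WV: "W \<subseteq> V" and VU: "V \<subseteq> U" and u: "u \<in> U" "u \<notin> V"
    and dec: "\<And>x. x \<in> U \<Longrightarrow> \<exists>c. x - scale c u \<in> V"
  shows "quot_basis U W (insert u C)"
  unfolding quot_basis_def
proof (intro conjI ballI allI impI)
  have fC: "finite C" and CV: "C \<subseteq> V" using C by (auto simp: quot_basis_def)
  have uC: "u \<notin> C" using CV u by auto
  show "finite (insert u C)" "insert u C \<subseteq> U" using fC CV VU u by auto
  fix x assume "x \<in> U"
  then obtain c where "x - scale c u \<in> V" using dec by blast
  then obtain a where a: "x - scale c u - (\<Sum>b\<in>C. scale (a b) b) \<in> W"
    using C by (auto simp: quot_basis_def)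
  have "(\<Sum>b\<in>C. scale ((a(u:=c)) b) b) = (\<Sum>b\<in>C. scale (a b) b)"
    by (rule sum.cong) (use uC in auto)
  then have "x - (\<Sum>b\<in>insert u C. scale ((a(u:=c)) b) b) \<in> W"
    using a fC uC by (simp add: algebra_simps)
  then show "\<exists>a. x - (\<Sum>b\<in>insert u C. scale (a b) b) \<in> W" by blast
next
  fix a b assume s: "(\<Sum>b\<in>insert u C. scale (a b) b) \<in> W" and b: "b \<in> insert u C"
  have fC: "finite C" and CV: "C \<subseteq> V" using C by (auto simp: quot_basis_def)
  have uC: "u \<notin> C" using CV u by auto
  have s1: "scale (a u) u + (\<Sum>b\<in>C. scale (a b) b) \<in> W" using s fC uC by simp
  have "(\<Sum>b\<in>C. scale (a b) b) \<in> V" by (intro subspace_sum[OF V] subspace_scale[OF V]) (use CV in auto)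
  with s1 WV have "scale (a u) u \<in> V"
    using subspace_diff[OF V, of "scale (a u) u + (\<Sum>b\<in>C. scale (a b) b)" "\<Sum>b\<in>C. scale (a b) b"] by auto
  have au: "a u = 0"
  proof (rule ccontr)
    assume n: "a u \<noteq> 0"
    have "scale (inverse (a u)) (scale (a u) u) \<in> V"
      by (rule subspace_scale[OF V]) fact
    then show False using n u by simp
  qed
  with s1 C have "\<forall>b\<in>C. a b = 0" by (simp add: quot_basis_def)
  then show "a b = 0" using b au by auto
qed

text \<open>
  The source of all finiteness of codimensions: if \<open>U\<close> exceeds \<open>W\<close> by finitely many
  directions at most, then \<open>U / (U \<inter> W)\<close> is finite dimensional. Each vector of \<open>B\<close> contributes at most one
  vector to a basis, which is the induction step.
\<close>

lemma has_codim_Int_span: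
  assumes W: "subspace W" and "finite B"
  shows "subspace U \<Longrightarrow> U \<subseteq> span (W \<union> B) \<Longrightarrow> \<exists>n. has_codim U (U \<inter> W) n"
  using \<open>finite B\<close>
proof (induction B arbitrary: U rule: finite_induct)
  case empty
  then have "U \<inter> W = U" using W by (auto simp: span_eq_iff[THEN iffD2])
  then show ?case using has_codim_refl empty by metis
next
  case (insert b B)
  define U' where "U' = U \<inter> span (W \<union> B)"
  have sU': "subspace U'" unfolding U'_def by (intro subspace_inter insert.prems subspace_span)
  have "W \<subseteq> span (W \<union> B)" by (auto intro: span_base)
  then have eq: "U' \<inter> W = U \<inter> W" unfolding U'_def by auto
  obtain n where n: "has_codim U' (U \<inter> W) n"
    using insert.IH[OF sU'] eq unfolding U'_def by auto
  then obtain C where C: "quot_basis U' (U \<inter> W) C" by (auto simp: has_codim_def)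
  show ?case
  proof (cases "U' = U")
    case True then show ?thesis using n by auto
  next
    case False
    then obtain u where u: "u \<in> U" "u \<notin> U'" unfolding U'_def by auto
    have ins: "\<exists>k. x - scale k b \<in> span (W \<union> B)" if "x \<in> U" for x
      using insert.prems(2) that span_breakdown_eq[of x b "W \<union> B"] by auto
    obtain k where k: "u - scale k b \<in> span (W \<union> B)" using ins u by blast
    have k0: "k \<noteq> 0" using k u unfolding U'_def by auto
    have "quot_basis U (U \<inter> W) (insert u C)"
    proof (rule quot_basis_insert[OF sU' _ C _ _ u])
      show "subspace (U \<inter> W)" using insert.prems W by (intro subspace_inter)
      show "U \<inter> W \<subseteq> U'" using eq by auto
      show "U' \<subseteq> U" unfolding U'_def by auto
      fix x assume x: "x \<in> U"
      obtain l where l: "x - scale l b \<in> span (W \<union> B)" using ins x by blast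
      have "x - scale l b - scale (l/k) (u - scale k b) \<in> span (W \<union> B)"
        by (rule span_diff[OF l span_scale[OF k]])
      also have "x - scale l b - scale (l/k) (u - scale k b) = x - scale (l/k) u"
        using k0 by (simp add: scale_right_diff_distrib)
      finally show "\<exists>c. x - scale c u \<in> U'" unfolding U'_def
        using x u insert.prems by (auto intro!: exI[of _ "l/k"] subspace_diff subspace_scale)
    qed
    then show ?thesis unfolding has_codim_def
      using insert.prems W by (auto intro!: subspace_inter)
  qed
qed

lemma quot_basis_span:
  assumes "quot_basis V W B" shows "V \<subseteq> span (W \<union> B)"
proof
  fix v assume "v \<in> V"
  then obtain a where a: "v - (\<Sum>b\<in>B. scale (a b) b) \<in> W" using assms by (auto simp: quot_basis_def)
  have "v - (\<Sum>b\<in>B. scale (a b) b) + (\<Sum>b\<in>B. scale (a b) b) \<in> span (W \<union> B)"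
    by (intro span_add span_sum span_scale) (use a in \<open>auto intro: span_base\<close>)
  then show "v \<in> span (W \<union> B)" by simp
qed

lemma has_codim_span:
  assumes "has_codim V W n" shows "\<exists>B. finite B \<and> B \<subseteq> V \<and> V \<subseteq> span (W \<union> B)"
proof -
  obtain B where B: "quot_basis V W B" using assms by (auto simp: has_codim_def)
  then show ?thesis using quot_basis_span[OF B] by (auto simp: quot_basis_def)
qed

lemma has_codim_spanI:
  assumes "subspace V" "subspace W" "W \<subseteq> V" "finite B" "V \<subseteq> span (W \<union> B)"
  shows "\<exists>n. has_codim V W n"
  using has_codim_Int_span[OF assms(2,4,1,5)] assms(3) by (simp add: Int_absorb1)

lemma has_codim_Int:
  assumes "has_codim V W n" "subspace U" "U \<subseteq> V"
  shows "\<exists>m. has_codim U (U \<inter> W) m"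
proof -
  obtain B where "finite B" "V \<subseteq> span (W \<union> B)" using has_codim_span[OF assms(1)] by blast
  then show ?thesis
    using has_codim_Int_span[OF has_codim_subspace(2)[OF assms(1)], of B U] assms(2,3) by blast
qed

lemma has_codim_between:
  assumes "has_codim V W n" "subspace U" "W \<subseteq> U" "U \<subseteq> V"
  shows "\<exists>m. has_codim V U m" "\<exists>m. has_codim U W m"
proof -
  obtain B where B: "finite B" "V \<subseteq> span (W \<union> B)" using has_codim_span[OF assms(1)] by blast
  have "V \<subseteq> span (U \<union> B)" using B(2) span_mono[of "W \<union> B" "U \<union> B"] assms by blast
  then show "\<exists>m. has_codim V U m" 
    by (intro has_codim_spanI[OF has_codim_subspace(1)[OF assms(1)] assms(2,4) B(1)])
  show "\<exists>m. has_codim U W m" using has_codim_Int[OF assms(1,2,4)] assms(3) by (simp add: Int_absorb1)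
qed

lemma has_codim_trans:
  assumes "has_codim V W m" "has_codim W U n"
  shows "has_codim V U (m + n)"
proof -
  obtain B where B: "quot_basis V W B" "card B = m" using assms by (auto simp: has_codim_def)
  obtain C where C: "quot_basis W U C" "card C = n" using assms by (auto simp: has_codim_def)
  have fin: "finite B" "finite C" using B C by (auto simp: quot_basis_def)
  have CW: "C \<subseteq> W" using C by (simp add: quot_basis_def)
  have sW: "subspace W" and WV: "W \<subseteq> V" and UW: "U \<subseteq> W" using assms by (auto simp: has_codim_def)
  have disj: "B \<inter> C = {}"
  proof (rule ccontr)
    assume "B \<inter> C \<noteq> {}"
    then obtain b where b: "b \<in> B" "b \<in> W" using CW by auto
    have "(\<Sum>x\<in>B. scale (if x = b then 1 else 0) x) = (\<Sum>x\<in>{b}. scale (if x = b then 1 else 0) x)"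
      by (rule sum.mono_neutral_right) (use fin b in auto)
    then have "(\<Sum>x\<in>B. scale (if x = b then 1 else 0) x) \<in> W" using b by simp
    then show False using quot_basis_coeff_0[OF B(1), of "\<lambda>x. if x = b then 1 else 0" b] b by simp
  qed
  have sumC: "(\<Sum>c\<in>C. scale (a c) c) \<in> W" for a
    by (intro subspace_sum[OF sW] subspace_scale[OF sW]) (use CW in auto)
  have "quot_basis V U (B \<union> C)" unfolding quot_basis_def
  proof (intro conjI ballI allI impI)
    show "finite (B \<union> C)" "B \<union> C \<subseteq> V" using fin CW WV B by (auto simp: quot_basis_def)
    fix v assume "v \<in> V"
    then obtain a where a: "v - (\<Sum>b\<in>B. scale (a b) b) \<in> W" using B by (auto simp: quot_basis_def)
    then obtain c where c: "v - (\<Sum>b\<in>B. scale (a b) b) - (\<Sum>b\<in>C. scale (c b) b) \<in> U"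
      using C by (auto simp: quot_basis_def)
    define e where "e x = (if x \<in> B then a x else c x)" for x
    have "(\<Sum>b\<in>B. scale (a b) b) = (\<Sum>b\<in>B. scale (e b) b)" by (simp add: e_def)
    moreover have "(\<Sum>b\<in>C. scale (c b) b) = (\<Sum>b\<in>C. scale (e b) b)"
      by (rule sum.cong) (use disj in \<open>auto simp: e_def\<close>)
    ultimately have "v - (\<Sum>b\<in>B\<union>C. scale (e b) b) \<in> U"
      using c fin disj by (simp add: sum.union_disjoint diff_diff_add)
    then show "\<exists>a. v - (\<Sum>b\<in>B\<union>C. scale (a b) b) \<in> U" by blast
  next
    fix a b assume s: "(\<Sum>b\<in>B \<union> C. scale (a b) b) \<in> U" and b: "b \<in> B \<union> C"
    have s2: "(\<Sum>b\<in>B. scale (a b) b) + (\<Sum>b\<in>C. scale (a b) b) \<in> U"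
      using s fin disj by (simp add: sum.union_disjoint)
    then have "(\<Sum>b\<in>B. scale (a b) b) \<in> W"
      using subspace_diff[OF sW _ sumC[of a]] UW by fastforce
    then have aB: "\<forall>b\<in>B. a b = 0" using B by (simp add: quot_basis_def)
    then have "(\<Sum>b\<in>C. scale (a b) b) \<in> U" using s2 by simp
    then have "\<forall>b\<in>C. a b = 0" using C by (simp add: quot_basis_def)
    then show "a b = 0" using b aB by auto
  qed
  moreover have "card (B \<union> C) = m + n" using B C fin disj by (simp add: card_Un_disjoint)
  ultimately show ?thesis unfolding has_codim_def using assms by (auto simp: has_codim_def)
qed

lemma has_codim_image:
  assumes T: "lin T" and V: "has_codim V W n"
  shows "\<exists>m. has_codim (T ` V) (T ` W) m"
proof -
  interpret T: module_hom scale scale T by fact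
  obtain B where B: "finite B" "V \<subseteq> span (W \<union> B)" using has_codim_span[OF V] by blast
  have "T ` V \<subseteq> T ` span (W \<union> B)" using B by auto
  also have "\<dots> = span (T ` W \<union> T ` B)" using T.span_image[of "W \<union> B"] by (simp add: image_Un)
  finally have "T ` V \<subseteq> span (T ` W \<union> T ` B)" .
  moreover have "subspace (T ` V)" "subspace (T ` W)" "T ` W \<subseteq> T ` V"
    using has_codim_subspace[OF V] by (auto intro: T.subspace_image)
  ultimately show ?thesis using B(1) by (intro has_codim_spanI[where B = "T ` B"]) auto
qed

lemma has_codim_image_inj:
  assumes T: "lin T" and V: "has_codim V W n" and inj: "inj_on T V"
  shows "has_codim (T ` V) (T ` W) n"
proof -
  interpret T: module_hom scale scale T by fact
  obtain B where B: "quot_basis V W B" "card B = n" using V by (auto simp: has_codim_def)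
  have BV: "B \<subseteq> V" and fin: "finite B" using B by (auto simp: quot_basis_def)
  have sV: "subspace V" and WV: "W \<subseteq> V" using V by (auto simp: has_codim_def)
  have injB: "inj_on T B" using inj BV inj_on_subset by blast
  have sumB: "(\<Sum>b\<in>B. scale (a b) b) \<in> V" for a
    by (intro subspace_sum[OF sV] subspace_scale[OF sV]) (use BV in auto)
  have Tsum: "(\<Sum>y\<in>T ` B. scale (a y) y) = T (\<Sum>b\<in>B. scale (a (T b)) b)" for a
    using injB by (simp add: sum.reindex T.sum T.scale)
  have "quot_basis (T ` V) (T ` W) (T ` B)" unfolding quot_basis_def
  proof (intro conjI ballI allI impI)
    show "finite (T ` B)" "T ` B \<subseteq> T ` V" using fin BV by auto
    fix y assume "y \<in> T ` V"
    then obtain v where v: "v \<in> V" "y = T v" by auto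
    obtain a where a: "v - (\<Sum>b\<in>B. scale (a b) b) \<in> W" using v B by (auto simp: quot_basis_def)
    define e where "e y = a (the_inv_into B T y)" for y
    have "(\<Sum>b\<in>B. scale (e (T b)) b) = (\<Sum>b\<in>B. scale (a b) b)"
      by (rule sum.cong) (use injB in \<open>auto simp: e_def the_inv_into_f_f\<close>)
    then have "y - (\<Sum>y\<in>T ` B. scale (e y) y) = T (v - (\<Sum>b\<in>B. scale (a b) b))"
      by (simp add: Tsum v T.diff)
    then show "\<exists>a. y - (\<Sum>y\<in>T ` B. scale (a y) y) \<in> T ` W" using a by auto
  next
    fix a y assume s: "(\<Sum>y\<in>T ` B. scale (a y) y) \<in> T ` W" and y: "y \<in> T ` B"
    then obtain w where w: "w \<in> W" "T (\<Sum>b\<in>B. scale (a (T b)) b) = T w" unfolding Tsum by auto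
    then have "(\<Sum>b\<in>B. scale (a (T b)) b) = w" using inj_onD[OF inj w(2) sumB] WV by blast
    then have "(\<Sum>b\<in>B. scale (a (T b)) b) \<in> W" using w by simp
    then have "a (T b) = 0" if "b \<in> B" for b
      using quot_basis_coeff_0[OF B(1), of "\<lambda>b. a (T b)"] that by simp
    then show "a y = 0" using y by auto
  qed
  moreover have "card (T ` B) = n" using injB B by (simp add: card_image)
  ultimately show ?thesis using V by (auto simp: has_codim_def intro!: T.subspace_image)
qed

abbreviation (input) plus_space :: "'a set \<Rightarrow> 'a set \<Rightarrow> 'a set" where
  "plus_space A M \<equiv> {x + y |x y. x \<in> A \<and> y \<in> M}"

text \<open>
  Adding a subspace that is independent of \<open>A\<close> changes neither a basis of \<open>A / A0\<close> nor its
  independence.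
\<close>

lemma has_codim_plus:
  assumes A: "has_codim A A0 n" and M: "subspace M" and disj: "A \<inter> M \<subseteq> {0}"
  shows "has_codim (plus_space A M) (plus_space A0 M) n"
proof -
  obtain B where B: "quot_basis A A0 B" "card B = n" using A by (auto simp: has_codim_def)
  have sA: "subspace A" "subspace A0" "A0 \<subseteq> A" using A by (auto simp: has_codim_def)
  have BA: "B \<subseteq> A" using B by (auto simp: quot_basis_def)
  have sumB: "(\<Sum>b\<in>B. scale (a b) b) \<in> A" for a
    by (intro subspace_sum[OF sA(1)] subspace_scale[OF sA(1)]) (use BA in auto)
  have "quot_basis (plus_space A M) (plus_space A0 M) B" unfolding quot_basis_def
  proof (intro conjI ballI allI impI)
    show "finite B" using B by (auto simp: quot_basis_def)
    show "B \<subseteq> plus_space A M" using BA subspace_0[OF M] by force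
    fix v assume "v \<in> plus_space A M"
    then obtain x y where v: "v = x + y" "x \<in> A" "y \<in> M" by auto
    obtain a where a: "x - (\<Sum>b\<in>B. scale (a b) b) \<in> A0" using v B by (auto simp: quot_basis_def)
    have "v - (\<Sum>b\<in>B. scale (a b) b) = (x - (\<Sum>b\<in>B. scale (a b) b)) + y" using v by simp
    then show "\<exists>a. v - (\<Sum>b\<in>B. scale (a b) b) \<in> plus_space A0 M" using a v by blast
  next
    fix a b assume s: "(\<Sum>b\<in>B. scale (a b) b) \<in> plus_space A0 M" and b: "b \<in> B"
    then obtain x y where xy: "(\<Sum>b\<in>B. scale (a b) b) = x + y" "x \<in> A0" "y \<in> M" by auto
    have "y = (\<Sum>b\<in>B. scale (a b) b) - x" using xy by simp
    then have "y \<in> A" using subspace_diff[OF sA(1) sumB, of x a] xy sA by auto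
    then have "y = 0" using disj xy by blast
    then have "(\<Sum>b\<in>B. scale (a b) b) \<in> A0" using xy by simp
    then show "a b = 0" using b B by (simp add: quot_basis_def)
  qed
  then show ?thesis unfolding has_codim_def using B sA M by (auto intro!: subspace_sums)
qed

lemma finite_dim_mono: "finite_dim V \<Longrightarrow> W \<subseteq> V \<Longrightarrow> finite_dim W"
  unfolding finite_dim_def by blast

lemma finite_dim_image:
  assumes T: "lin T" and "finite_dim V" shows "finite_dim (T ` V)"
proof -
  interpret T: module_hom scale scale T by fact
  obtain B where "finite B" "V \<subseteq> span B" using assms(2) by (auto simp: finite_dim_def)
  then have "T ` V \<subseteq> span (T ` B)" "finite (T ` B)" using T.span_image[of B] by auto
  then show ?thesis by (auto simp: finite_dim_def)
qed

lemma finite_dim_has_codim_0: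
  assumes "subspace V" "finite_dim V" shows "\<exists>n. has_codim V {0} n"
proof -
  obtain B where B: "finite B" "V \<subseteq> span B" using assms(2) by (auto simp: finite_dim_def)
  then have "V \<subseteq> span ({0} \<union> B)" by (simp add: span_insert_0)
  then show ?thesis using has_codim_spanI[OF assms(1) subspace_single_0 _ B(1)] subspace_0[OF assms(1)] by simp
qed

lemma has_codim_0_finite_dim: "has_codim V {0} n \<Longrightarrow> finite_dim V"
  unfolding finite_dim_def using has_codim_span[of V "{0}" n] by (metis insert_is_Un span_insert_0)

section \<open>The index of a Fredholm operator\<close>

text \<open>
  Vectors whose images span \<open>T ` V\<close> modulo \<open>W\<close> span \<open>V\<close> modulo the preimage of \<open>W\<close>.
\<close>

lemma has_codim_vimage:
  assumes T: "lin T" and V: "subspace V" and Y: "has_codim Y W n" and TV: "T ` V \<subseteq> Y"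
  shows "\<exists>m. has_codim V {x\<in>V. T x \<in> W} m"
proof -
  interpret T: module_hom scale scale T by fact
  have sW: "subspace W" using Y by (simp add: has_codim_def)
  obtain k where k: "has_codim (T ` V) (T ` V \<inter> W) k"
    using has_codim_Int[OF Y T.subspace_image[OF V] TV] by blast
  obtain C where C: "finite C" "C \<subseteq> T ` V" "T ` V \<subseteq> span (T ` V \<inter> W \<union> C)"
    using has_codim_span[OF k] by blast
  then obtain B where B: "finite B" "B \<subseteq> V" "C = T ` B" by (meson finite_subset_image)
  let ?K = "{x\<in>V. T x \<in> W}"
  have sK: "subspace ?K" using V sW by (auto simp: subspace_def T.add T.scale T.zero)
  have TK: "T ` V \<inter> W = T ` ?K" by auto
  have "V \<subseteq> span (?K \<union> B)"
  proof
    fix v assume v: "v \<in> V"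
    have "T v \<in> span (T ` (?K \<union> B))" using C(3) v B(3) TK by (auto simp: image_Un)
    then obtain w where w: "w \<in> span (?K \<union> B)" "T v = T w" unfolding T.span_image by auto
    have "w \<in> V" using w(1) span_minimal[of "?K \<union> B" V] B(2) V by auto
    then have "v - w \<in> ?K" using v w sW by (simp add: T.diff subspace_diff[OF V] subspace_0)
    then have "(v - w) + w \<in> span (?K \<union> B)" using w(1) by (intro span_add) (auto intro: span_base)
    then show "v \<in> span (?K \<union> B)" by simp
  qed
  then show ?thesis by (intro has_codim_spanI[OF V sK _ B(1)]) auto
qed

lemma has_codim_kernel:
  assumes F: "lin F" and V: "subspace V" and fin: "finite_dim (F ` V)"
  shows "\<exists>n. has_codim V {x\<in>V. F x = 0} n"
proof -
  interpret F: module_hom scale scale F by fact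
  obtain n where "has_codim (F ` V) {0} n"
    using finite_dim_has_codim_0[OF F.subspace_image[OF V] fin] by blast
  from has_codim_vimage[OF F V this] show ?thesis by simp
qed

text \<open>
  \<open>T\<close> restricts to a bijection between subspaces of finite codimension, so that the
  difference of the two codimensions is \<open>dim ker T - dim Y / T ` X\<close>. The subspace \<open>X0\<close> need not be a complement of the
  kernel, which leaves room to shrink it.
\<close>

definition index_on :: "('a \<Rightarrow> 'a) \<Rightarrow> 'a set \<Rightarrow> 'a set \<Rightarrow> 'a set \<Rightarrow> int \<Rightarrow> bool" where
  "index_on T X Y X0 i \<longleftrightarrow> inj_on T X0 \<and>
     (\<exists>m n. has_codim X X0 m \<and> has_codim Y (T ` X0) n \<and> i = int m - int n)"

definition fredholm_index :: "('a \<Rightarrow> 'a) \<Rightarrow> 'a set \<Rightarrow> 'a set \<Rightarrow> int \<Rightarrow> bool" where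
  "fredholm_index T X Y i \<longleftrightarrow> lin T \<and> T ` X \<subseteq> Y \<and> (\<exists>X0. index_on T X Y X0 i)"

text \<open>
  Shrinking \<open>X0\<close> by a finite codimension shrinks \<open>T ` X0\<close> by the same codimension, because \<open>T\<close> is injective
  there. Independence of the index from \<open>X0\<close> and its additivity both rest on this.
\<close>

lemma index_on_restrict:
  assumes T: "lin T" and i: "index_on T X Y X0 i" and X1: "has_codim X0 X1 l"
  shows "index_on T X Y X1 i"
proof -
  obtain m n where mn: "has_codim X X0 m" "has_codim Y (T ` X0) n" "i = int m - int n"
    and inj: "inj_on T X0" using i by (auto simp: index_on_def)
  have "has_codim X X1 (m + l)" using has_codim_trans[OF mn(1) X1] .
  moreover have "has_codim Y (T ` X1) (n + l)"
    using has_codim_trans[OF mn(2) has_codim_image_inj[OF T X1 inj]] .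
  moreover have "inj_on T X1" using inj inj_on_subset X1 by (auto simp: has_codim_def)
  moreover have "i = int (m + l) - int (n + l)" using mn by simp
  ultimately show ?thesis unfolding index_on_def by blast
qed

text \<open>
  Two choices of \<open>X0\<close> are compared with their intersection.
\<close>

lemma fredholm_index_unique:
  assumes "fredholm_index T X Y i" "fredholm_index T X Y j"
  shows "i = j"
proof -
  have T: "lin T" using assms by (simp add: fredholm_index_def)
  obtain X0 X1 where X0: "index_on T X Y X0 i" and X1: "index_on T X Y X1 j"
    using assms by (auto simp: fredholm_index_def)
  obtain m n where c: "has_codim X X0 m" "has_codim X X1 n"
    using X0 X1 unfolding index_on_def by blast
  obtain k where k: "has_codim X0 (X0 \<inter> X1) k"
    using has_codim_Int[OF c(2)] c(1) unfolding has_codim_def by blast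
  obtain l where l: "has_codim X1 (X0 \<inter> X1) l"
    using has_codim_Int[OF c(1)] c(2) unfolding has_codim_def by (metis Int_commute)
  have "index_on T X Y (X0 \<inter> X1) i" "index_on T X Y (X0 \<inter> X1) j"
    using index_on_restrict[OF T X0 k] index_on_restrict[OF T X1 l] by auto
  then show ?thesis unfolding index_on_def using has_codim_unique by metis
qed

text \<open>
  Shrink the two subspaces until the image of the first is the second; the codimensions of this
  common subspace of \<open>Y\<close> then cancel.
\<close>

lemma fredholm_index_compose:
  assumes "fredholm_index T X Y i" "fredholm_index S Y Z j"
  shows "fredholm_index (S \<circ> T) X Z (i + j)"
proof -
  have T: "lin T" and S: "lin S" and TX: "T ` X \<subseteq> Y" and SY: "S ` Y \<subseteq> Z"
    using assms by (auto simp: fredholm_index_def)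
  interpret T: module_hom scale scale T by fact
  obtain X0 Y0 where X0: "index_on T X Y X0 i" and Y0: "index_on S Y Z Y0 j"
    using assms by (auto simp: fredholm_index_def)
  obtain m n where c: "has_codim X X0 m" "has_codim Y Y0 n"
    using X0 Y0 unfolding index_on_def by blast
  have sX0: "subspace X0" "X0 \<subseteq> X" and sY0: "Y0 \<subseteq> Y" "subspace Y0" using c by (auto simp: has_codim_def)
  define X1 where "X1 = {x\<in>X0. T x \<in> Y0}"
  obtain k where k: "has_codim X0 X1 k"
    using has_codim_vimage[OF T sX0(1) c(2)] sX0(2) TX unfolding X1_def by blast
  have "T ` X1 = Y0 \<inter> T ` X0" by (auto simp: X1_def)
  moreover obtain q where "has_codim Y (T ` X0) q" using X0 by (auto simp: index_on_def)
  ultimately obtain l where l: "has_codim Y0 (T ` X1) l" using has_codim_Int[of Y "T ` X0" q Y0] sY0 by auto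
  have i: "index_on T X Y X1 i" by (rule index_on_restrict[OF T X0 k])
  have j: "index_on S Y Z (T ` X1) j" by (rule index_on_restrict[OF S Y0 l])
  obtain a b where ab: "has_codim X X1 a" "has_codim Y (T ` X1) b" "i = int a - int b"
    using i by (auto simp: index_on_def)
  obtain a' b' where ab': "has_codim Y (T ` X1) a'" "has_codim Z (S ` T ` X1) b'" "j = int a' - int b'"
    using j by (auto simp: index_on_def)
  have "b = a'" using ab(2) ab'(1) has_codim_unique by blast
  then have "index_on (S \<circ> T) X Z X1 (i + j)" unfolding index_on_def
    using ab ab' i j comp_inj_on[of T X1 S] unfolding index_on_def image_comp by fastforce
  moreover have "lin (S \<circ> T)" using T S by (rule module_hom_compose)
  ultimately show ?thesis unfolding fredholm_index_def using TX SY by fastforce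
qed

lemma index_on_cong: "(\<And>x. x \<in> X \<Longrightarrow> T x = S x) \<Longrightarrow> index_on T X Y X0 i \<Longrightarrow> index_on S X Y X0 i"
proof -
  assume a: "\<And>x. x \<in> X \<Longrightarrow> T x = S x" and i: "index_on T X Y X0 i"
  have "X0 \<subseteq> X" using i by (auto simp: index_on_def has_codim_def)
  then have "inj_on T X0 = inj_on S X0" "T ` X0 = S ` X0"
    using a by (auto intro!: inj_on_cong image_cong)
  then show "index_on S X Y X0 i" using i by (simp add: index_on_def)
qed

lemma fredholm_index_cong:
  assumes "fredholm_index T X Y i" "lin S" "\<And>x. x \<in> X \<Longrightarrow> T x = S x"
  shows "fredholm_index S X Y i"
  using assms index_on_cong[of X T S] unfolding fredholm_index_def by (metis image_cong)

text \<open>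
  An operator that is invertible from both sides up to Fredholm operators is Fredholm: \<open>B \<circ> A\<close>
  controls the kernel of \<open>A\<close>, and \<open>A \<circ> B\<close> controls its range.
\<close>

lemma fredholm_index_factor:
  assumes A: "lin A" "A ` X \<subseteq> Y" and B: "lin B" "B ` Y \<subseteq> X"
    and BA: "fredholm_index (B \<circ> A) X X i" and AB: "fredholm_index (A \<circ> B) Y Y j"
  shows "\<exists>a. fredholm_index A X Y a"
proof -
  interpret A: module_hom scale scale A by fact
  obtain X0 m where X0: "inj_on (B \<circ> A) X0" "has_codim X X0 m"
    using BA by (auto simp: fredholm_index_def index_on_def)
  obtain Y0 q n where Y0: "has_codim Y Y0 q" "has_codim Y ((A \<circ> B) ` Y0) n"
    using AB by (auto simp: fredholm_index_def index_on_def)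
  have sub: "(A \<circ> B) ` Y0 \<subseteq> A ` X" using B(2) Y0(1) unfolding has_codim_def by fastforce
  have "subspace (A ` X)" using has_codim_subspace(1)[OF X0(2)] by (rule A.subspace_image)
  then obtain k where "has_codim Y (A ` X) k" using has_codim_between(1)[OF Y0(2) _ sub A(2)] by blast
  moreover obtain l where "has_codim (A ` X) (A ` X0) l" using has_codim_image[OF A(1) X0(2)] by blast
  ultimately have "has_codim Y (A ` X0) (k + l)" by (rule has_codim_trans)
  moreover have "inj_on A X0" using X0(1) by (rule inj_on_imageI2)
  ultimately show ?thesis unfolding fredholm_index_def index_on_def using A X0(2) by blast
qed

lemma plus_space_commute: "plus_space A M = plus_space M A"
proof -
  have "plus_space A M \<subseteq> plus_space M A" for A M
  proof
    fix z assume "z \<in> plus_space A M"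
    then obtain x y where "z = y + x" "x \<in> A" "y \<in> M" by (auto simp: add.commute)
    then show "z \<in> plus_space M A" by blast
  qed
  then show ?thesis by blast
qed

text \<open>
  Let \<open>T\<close> be block triangular with respect to \<open>X = A \<oplus> M\<close> and \<open>Y = A' \<oplus> M'\<close>, with \<open>q\<close> the projection
  of \<open>Y\<close> onto \<open>M'\<close> along \<open>A'\<close>. Then the index is the sum of those of the diagonal blocks: \<open>T\<close> is injective on the sum of
  the two subspaces for the blocks, and the codimension of the image splits at \<open>A' + T ` M0\<close>, which
  equals \<open>A' + q ` T ` M0\<close>.
\<close>

lemma fredholm_index_triangular:
  assumes T: "lin T" and q: "lin q" "\<And>y. y \<in> A' \<Longrightarrow> q y = 0" "\<And>y. y \<in> M' \<Longrightarrow> q y = y"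
    and AM: "A \<inter> M \<subseteq> {0}" and TM: "\<And>x. x \<in> M \<Longrightarrow> T x - q (T x) \<in> A'"
    and A: "fredholm_index T A A' i" and M: "fredholm_index (q \<circ> T) M M' j"
  shows "fredholm_index T (plus_space A M) (plus_space A' M') (i + j)"
proof -
  interpret T: module_hom scale scale T by fact
  interpret q: module_hom scale scale q by fact
  obtain A0 m1 n1 where A0: "inj_on T A0" "has_codim A A0 m1" "has_codim A' (T ` A0) n1" "i = int m1 - int n1"
    using A by (auto simp: fredholm_index_def index_on_def)
  obtain M0 m2 n2 where M0: "inj_on (q \<circ> T) M0" "has_codim M M0 m2" "has_codim M' ((q \<circ> T) ` M0) n2" "j = int m2 - int n2"
    using M by (auto simp: fredholm_index_def index_on_def)
  have TA: "T ` A \<subseteq> A'" using A by (auto simp: fredholm_index_def)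
  have qTM: "q (T x) \<in> M'" if "x \<in> M" for x using M that by (auto simp: fredholm_index_def)
  have s: "subspace A" "subspace M" "subspace A'" "subspace M'" "subspace A0" "subspace M0" "A0 \<subseteq> A" "M0 \<subseteq> M"
    using A0 M0 by (auto simp: has_codim_def)
  have qT0: "x = 0" if "x \<in> M0" "q (T x) = 0" for x
    using inj_onD[OF M0(1), of x 0] that subspace_0[OF s(6)] by (simp add: T.zero q.zero)
  have T0: "x = 0" if "x \<in> A0" "T x = 0" for x
    using inj_onD[OF A0(1), of x 0] that subspace_0[OF s(5)] by (simp add: T.zero)
  have A'M': "A' \<inter> M' \<subseteq> {0}" using q by fastforce
  define X0 where "X0 = plus_space A0 M0"
  have sX0: "subspace X0" unfolding X0_def by (intro subspace_sums s)
  have "inj_on T X0" unfolding T.inj_on_iff_eq_0[OF sX0]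
  proof (intro ballI impI)
    fix x assume "x \<in> X0" and Tx: "T x = 0"
    then obtain a y where x: "x = a + y" "a \<in> A0" "y \<in> M0" by (auto simp: X0_def)
    have "T a \<in> A'" using x s TA by auto
    then have "q (T y) = q (T x)" using q(2) by (simp add: x T.add q.add)
    then have "y = 0" using qT0 x Tx by (simp add: q.zero)
    then show "x = 0" using T0 x Tx by simp
  qed
  moreover have "has_codim (plus_space A M) X0 (m1 + m2)"
  proof -
    have 1: "has_codim (plus_space A M) (plus_space A0 M) m1" by (rule has_codim_plus[OF A0(2) s(2) AM])
    have 2: "has_codim (plus_space M A0) (plus_space M0 A0) m2"
      by (rule has_codim_plus[OF M0(2) s(5)]) (use AM s in auto)
    show ?thesis unfolding X0_def
      using has_codim_trans[OF 1 2[unfolded plus_space_commute[of M A0] plus_space_commute[of M0 A0]]] .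
  qed
  moreover have "has_codim (plus_space A' M') (T ` X0) (n1 + n2)"
  proof -
    have 1: "has_codim (plus_space M' A') (plus_space ((q \<circ> T) ` M0) A') n2"
      by (rule has_codim_plus[OF M0(3) s(3)]) (use A'M' in auto)
    have 2: "has_codim (plus_space A' (T ` M0)) (plus_space (T ` A0) (T ` M0)) n1"
    proof (rule has_codim_plus[OF A0(3) T.subspace_image[OF s(6)]])
      show "A' \<inter> T ` M0 \<subseteq> {0}" using q(2) qT0 T.zero by blast
    qed
    have eq: "plus_space ((q \<circ> T) ` M0) A' = plus_space A' (T ` M0)"
    proof (intro subset_antisym subsetI)
      fix z assume "z \<in> plus_space ((q \<circ> T) ` M0) A'"
      then obtain x y where z: "z = q (T x) + y" "x \<in> M0" "y \<in> A'" by auto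
      have "z = (y - (T x - q (T x))) + T x" using z by simp
      moreover have "y - (T x - q (T x)) \<in> A'" by (rule subspace_diff[OF s(3) z(3) TM]) (use z s in auto)
      ultimately show "z \<in> plus_space A' (T ` M0)" using z by blast
    next
      fix z assume "z \<in> plus_space A' (T ` M0)"
      then obtain x y where z: "z = y + T x" "x \<in> M0" "y \<in> A'" by auto
      have "z = q (T x) + (y + (T x - q (T x)))" using z by simp
      moreover have "y + (T x - q (T x)) \<in> A'" by (rule subspace_add[OF s(3) z(3) TM]) (use z s in auto)
      ultimately show "z \<in> plus_space ((q \<circ> T) ` M0) A'" using z(2)
        by (intro CollectI exI[of _ "q (T x)"] exI[of _ "y + (T x - q (T x))"] conjI) auto
    qed
    have TX0: "T ` X0 = plus_space (T ` A0) (T ` M0)"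
    proof (intro subset_antisym subsetI)
      fix z assume "z \<in> T ` X0"
      then obtain x y where "z = T x + T y" "x \<in> A0" "y \<in> M0" by (auto simp: X0_def T.add)
      then show "z \<in> plus_space (T ` A0) (T ` M0)" by blast
    next
      fix z assume "z \<in> plus_space (T ` A0) (T ` M0)"
      then obtain x y where "z = T (x + y)" "x \<in> A0" "y \<in> M0" by (auto simp: T.add)
      then show "z \<in> T ` X0" unfolding X0_def by blast
    qed
    have "has_codim (plus_space M' A') (plus_space (T ` A0) (T ` M0)) (n2 + n1)"
      using has_codim_trans[OF 1[unfolded eq] 2] .
    then show ?thesis unfolding TX0 plus_space_commute[of A' M'] by (simp add: add.commute)
  qed
  moreover have "T ` plus_space A M \<subseteq> plus_space A' M'"
  proof
    fix z assume "z \<in> T ` plus_space A M"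
    then obtain x y where z: "z = T x + T y" "x \<in> A" "y \<in> M" by (auto simp: T.add)
    have "z = (T x + (T y - q (T y))) + q (T y)" using z by simp
    moreover have "T x + (T y - q (T y)) \<in> A'" using z TA TM by (intro subspace_add s) auto
    ultimately show "z \<in> plus_space A' M'" using qTM z by blast
  qed
  moreover have "i + j = int (m1 + m2) - int (n1 + n2)" using A0 M0 by simp
  ultimately show ?thesis unfolding fredholm_index_def index_on_def using T by blast
qed

section \<open>Orthogonal projections\<close>

lemma real_subspace: "subspace V \<Longrightarrow> real_vector.subspace V"
  unfolding subspace_def real_vector.subspace_def using scale_of_real by metis

lemma conj_0: "conj (0::'k) = 0" using conj_add[of 0 "0::'k"] by simp
lemma conj_1: "conj (1::'k) = 1" using conj_mult_self[of "1::'k"] by simp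

lemma ip_add_right: "ip z (x + y) = ip z x + ip z y"
  using ip_conj[of z "x + y"] ip_conj[of z x] ip_conj[of z y] by (simp add: ip_add_left conj_add)

lemma ip_eq_0_sym: "ip x y = 0 \<Longrightarrow> ip y x = 0"
  using ip_conj[of y x] conj_0 by simp

lemma ip_0_left: "ip 0 x = 0"
  using ip_add_left[of 0 0 x] by simp

lemma ip_diff_left: "ip (x - y) z = ip x z - ip y z"
  using ip_add_left[of "x - y" y z] by simp

lemma of_real_inner: "of_real (2 * inner x y) = ip x y + ip y x"
proof -
  have "of_real ((norm (x + y))\<^sup>2) = ip x x + ip y y + (ip x y + ip y x)"
    unfolding ip_self[symmetric] by (simp only: ip_add_left ip_add_right add_ac)
  moreover have "(norm (x + y))\<^sup>2 = (norm x)\<^sup>2 + (norm y)\<^sup>2 + 2 * inner x y"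
    unfolding power2_norm_eq_inner by (simp add: inner_add_left inner_add_right inner_commute)
  ultimately show ?thesis by (simp add: ip_self)
qed

text \<open>
  On a subspace over the field \<open>'k\<close> orthogonality for the real inner product is orthogonality for \<open>ip\<close>:
  if \<open>ip v x\<close> were not 0, a multiple \<open>u\<close> of \<open>v\<close> would satisfy \<open>ip u x = 1\<close>, and then \<open>inner x u = 1\<close>. Hence
  projections can be built from the real structure and are still linear over \<open>'k\<close>.
\<close>

lemma inner_orthogonal_iff_ip:
  assumes V: "subspace V"
  shows "(\<forall>v\<in>V. inner x v = 0) \<longleftrightarrow> (\<forall>v\<in>V. ip x v = 0)"
proof
  assume a: "\<forall>v\<in>V. inner x v = 0"
  show "\<forall>v\<in>V. ip x v = 0"
  proof (intro ballI, rule ip_eq_0_sym, rule ccontr)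
    fix v assume v: "v \<in> V" and nz: "ip v x \<noteq> 0"
    define u where "u = scale (inverse (ip v x)) v"
    have "ip u x = 1" using nz by (simp add: u_def ip_scale_left)
    moreover have "ip x u = 1" using ip_conj[of x u] conj_1 calculation by simp
    moreover have "inner x u = 0" using a V v by (simp add: u_def subspace_scale)
    ultimately show False using of_real_inner[of x u] by simp
  qed
next
  assume a: "\<forall>v\<in>V. ip x v = 0"
  show "\<forall>v\<in>V. inner x v = 0"
  proof
    fix v assume "v \<in> V"
    then have "ip x v = 0" using a by blast
    then have "(of_real (2 * inner x v) :: 'k) = 0" unfolding of_real_inner by (simp add: ip_eq_0_sym)
    then show "inner x v = 0" by simp
  qed
qed

text \<open>
  Defined with the real inner product, for which the geometry is available; it is a subspace over \<open>'k\<close>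
  by \<open>inner_orthogonal_iff_ip\<close> whenever \<open>V\<close> is one.
\<close>

definition orth :: "'a set \<Rightarrow> 'a set" where
  "orth V = {x. \<forall>v\<in>V. inner x v = 0}"

lemma closed_subspace_orth: assumes "subspace V" shows "closed_subspace (orth V)"
  unfolding closed_subspace_def
proof
  show "subspace (orth V)"
    unfolding orth_def inner_orthogonal_iff_ip[OF assms]
    by (auto simp: subspace_def ip_0_left ip_add_left ip_scale_left)
  have "orth V = (\<Inter>v\<in>V. {x. inner x v = 0})" by (auto simp: orth_def)
  then show "closed (orth V)" by (auto intro!: closed_INT closed_Collect_eq continuous_intros)
qed

definition proj :: "'a set \<Rightarrow> 'a \<Rightarrow> 'a" where
  "proj V x = (SOME p. p \<in> V \<and> x - p \<in> orth V)"

lemma proj_mem_orth: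
  assumes "closed_subspace V"
  shows proj_mem: "proj V x \<in> V" and proj_orth: "x - proj V x \<in> orth V"
proof -
  have "\<exists>p. p \<in> V \<and> x - p \<in> orth V"
    using closed_subspace_orthogonal_decomposition[of V x] real_subspace assms
    unfolding closed_subspace_def orth_def by auto
  from someI_ex[OF this] show "proj V x \<in> V" "x - proj V x \<in> orth V" unfolding proj_def by auto
qed

lemma orth_disjoint: "x \<in> V \<Longrightarrow> x \<in> orth V \<Longrightarrow> x = 0"
  by (force simp: orth_def)

lemma proj_unique:
  assumes V: "closed_subspace V" and p: "p \<in> V" "x - p \<in> orth V"
  shows "proj V x = p"
proof -
  have s: "subspace V" "subspace (orth V)"
    using V closed_subspace_orth by (auto simp: closed_subspace_def)
  have "proj V x - p \<in> V" using p proj_mem[OF V] subspace_diff[OF s(1)] by auto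
  moreover have "proj V x - p \<in> orth V"
    using subspace_diff[OF s(2) p(2) proj_orth[OF V, of x]] by simp
  ultimately show ?thesis using orth_disjoint by fastforce
qed

lemma proj_id: "closed_subspace V \<Longrightarrow> x \<in> V \<Longrightarrow> proj V x = x"
  by (rule proj_unique) (auto simp: orth_def)

lemma proj_0: "closed_subspace V \<Longrightarrow> x \<in> orth V \<Longrightarrow> proj V x = 0"
  by (rule proj_unique) (auto simp: closed_subspace_def subspace_0)

lemma lin_proj: assumes V: "closed_subspace V" shows "lin (proj V)"
proof -
  have s: "subspace V" "subspace (orth V)"
    using V closed_subspace_orth by (auto simp: closed_subspace_def)
  have "proj V (x + y) = proj V x + proj V y" for x y
    using subspace_add[OF s(2) proj_orth[OF V, of x] proj_orth[OF V, of y]]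
    by (intro proj_unique V subspace_add[OF s(1)] proj_mem) (simp_all add: algebra_simps)
  moreover have "proj V (scale c x) = scale c (proj V x)" for c x
    using subspace_scale[OF s(2) proj_orth[OF V, of x], of c]
    by (intro proj_unique V subspace_scale[OF s(1)] proj_mem) (simp_all add: algebra_simps)
  ultimately show ?thesis by (simp add: module_hom_iff module_axioms)
qed

lemma norm_proj:
  assumes V: "closed_subspace V"
  shows "norm (proj V x) \<le> norm x" "norm (x - proj V x) \<le> norm x"
proof -
  have "inner (x - proj V x) (proj V x) = 0"
    using proj_orth[OF V] proj_mem[OF V] by (auto simp: orth_def)
  then have "(norm x)\<^sup>2 = (norm (proj V x))\<^sup>2 + (norm (x - proj V x))\<^sup>2"
    unfolding power2_norm_eq_inner by (simp add: inner_diff_left inner_diff_right inner_commute)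
  then have "(norm (proj V x))\<^sup>2 \<le> (norm x)\<^sup>2" "(norm (x - proj V x))\<^sup>2 \<le> (norm x)\<^sup>2" by simp_all
  then show "norm (proj V x) \<le> norm x" "norm (x - proj V x) \<le> norm x"
    using power2_le_imp_le norm_ge_zero by blast+
qed

text \<open>
  One Gram--Schmidt step: \<open>u\<close> is the component of the new vector \<open>b\<close> orthogonal to the span of the others.
\<close>

lemma span_finite_orthogonal_decomposition:
  assumes "finite B" shows "\<exists>p\<in>span B. \<forall>v\<in>span B. ip (x - p) v = 0"
  using assms
proof (induction B arbitrary: x rule: finite_induct)
  case empty then show ?case using ip_eq_0_sym ip_0_left by (auto intro!: bexI[of _ 0])
next
  case (insert b B)
  obtain p where p: "p \<in> span B" "\<And>v. v \<in> span B \<Longrightarrow> ip (x - p) v = 0" using insert.IH by blast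
  obtain q where q: "q \<in> span B" "\<And>v. v \<in> span B \<Longrightarrow> ip (b - q) v = 0" using insert.IH by blast
  define u where "u = b - q"
  show ?case
  proof (cases "u = 0")
    case True
    then have "span (insert b B) = span B" using q by (simp add: u_def span_redundant)
    then show ?thesis using p by metis
  next
    case False
    then have nz: "ip u u \<noteq> 0" by (simp add: ip_self)
    define c where "c = ip (x - p) u / ip u u"
    define y where "y = x - (p + scale c u)"
    have y: "ip y v = ip (x - p) v - c * ip u v" for v
      by (simp add: y_def ip_diff_left ip_add_left ip_scale_left)
    have yu: "ip u y = 0" by (rule ip_eq_0_sym) (use nz y[of u] in \<open>simp add: c_def\<close>)
    have yB: "ip w y = 0" if "w \<in> span B" for w
      by (rule ip_eq_0_sym) (use y[of w] p q that in \<open>simp add: u_def\<close>)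
    have "ip y v = 0" if v: "v \<in> span (insert b B)" for v
    proof (rule ip_eq_0_sym)
      obtain k where k: "v - scale k b \<in> span B" using v span_breakdown_eq by blast
      have "v = scale k u + (scale k q + (v - scale k b))" by (simp add: u_def algebra_simps)
      moreover have "scale k q + (v - scale k b) \<in> span B" using k q by (intro span_add span_scale)
      ultimately show "ip v y = 0" using yu yB by (metis add_0 ip_add_left ip_scale_left mult_zero_right)
    qed
    moreover have "p + scale c u \<in> span (insert b B)" unfolding u_def
      using p q span_mono[of B "insert b B"] by (intro span_add span_scale span_diff) (auto intro: span_base)
    ultimately show ?thesis unfolding y_def by blast
  qed
qed

text \<open>
  A subspace onto which every vector can be projected orthogonally is closed: the error \<open>x - p\<close> of
  a limit point \<open>x\<close> is orthogonal to the vectors \<open>s n - p\<close>, and these converge to \<open>x - p\<close> itself.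
\<close>

lemma closed_subspace_span_finite:
  assumes "finite B" shows "closed_subspace (span B)"
  unfolding closed_subspace_def closed_sequential_limits
proof (intro conjI allI impI)
  fix s x assume s: "(\<forall>n. s n \<in> span B) \<and> s \<longlonglongrightarrow> x"
  obtain p where p: "p \<in> span B" "\<forall>v\<in>span B. inner (x - p) v = 0"
    using span_finite_orthogonal_decomposition[OF assms, of x] inner_orthogonal_iff_ip[OF subspace_span] by blast
  have "inner (x - p) (s n - p) = 0" for n using s p by (simp add: span_diff)
  moreover have "(\<lambda>n. inner (x - p) (s n - p)) \<longlonglongrightarrow> inner (x - p) (x - p)"
    using s by (intro tendsto_intros) auto
  ultimately have "inner (x - p) (x - p) = 0" using LIMSEQ_unique tendsto_const by fastforce
  then show "x \<in> span B" using p by simp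
qed simp

section \<open>Bounded operators and limits of operators of finite rank\<close>

text \<open>
  Operators defined on the whole space, so that sums and compositions need no bookkeeping of
  domains; an operator on a closed subspace is extended by 0 on the orthogonal complement.
\<close>

definition bop :: "('a \<Rightarrow> 'a) \<Rightarrow> bool" where
  "bop T \<longleftrightarrow> lin T \<and> (\<exists>C. \<forall>x. norm (T x) \<le> C * norm x)"

lemma bop_lin: "bop T \<Longrightarrow> lin T" by (simp add: bop_def)

lemma bop_bound: assumes "bop T" shows "\<exists>C>0. \<forall>x. norm (T x) \<le> C * norm x"
proof -
  obtain C where C: "\<And>x. norm (T x) \<le> C * norm x" using assms by (auto simp: bop_def)
  have "norm (T x) \<le> (\<bar>C\<bar> + 1) * norm x" for x
    by (rule order.trans[OF C]) (auto intro!: mult_right_mono)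
  then show ?thesis by (intro exI[of _ "\<bar>C\<bar> + 1"]) auto
qed

lemma bop_bounded_linear: assumes "bop T" shows "bounded_linear T"
proof -
  interpret T: module_hom scale scale T using assms by (rule bop_lin)
  obtain C where C: "\<And>x. norm (T x) \<le> C * norm x" using assms by (auto simp: bop_def)
  show ?thesis
  proof (rule bounded_linear_intro)
    show "T (r *\<^sub>R x) = r *\<^sub>R T x" for r x using T.scale[of "of_real r" x] by (simp add: scale_of_real)
    show "norm (T x) \<le> norm x * C" for x using C[of x] by (simp add: mult.commute)
  qed (rule T.add)
qed

lemma bop_compose: assumes "bop S" "bop T" shows "bop (\<lambda>x. S (T x))"
proof -
  obtain C where C: "C > 0" "\<And>x. norm (S x) \<le> C * norm x" using bop_bound[OF assms(1)] by blast
  obtain D where D: "\<And>x. norm (T x) \<le> D * norm x" using bop_bound[OF assms(2)] by blast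
  have "norm (S (T x)) \<le> C * D * norm x" for x
    using order.trans[OF C(2)[of "T x"] mult_left_mono[OF D[of x] less_imp_le[OF C(1)]]] by (simp add: mult.assoc)
  moreover have "lin (\<lambda>x. S (T x))"
    using module_hom_compose[OF bop_lin[OF assms(2)] bop_lin[OF assms(1)]] by (simp add: o_def)
  ultimately show ?thesis unfolding bop_def by blast
qed

lemma lin_id: "lin (\<lambda>x. x)" by (simp add: module_hom_iff module_axioms)

lemma lin_add: "lin S \<Longrightarrow> lin T \<Longrightarrow> lin (\<lambda>x. S x + T x)"
  by (simp add: module_hom_iff scale_right_distrib)

lemma lin_diff: "lin S \<Longrightarrow> lin T \<Longrightarrow> lin (\<lambda>x. S x - T x)"
  by (simp add: module_hom_iff scale_right_diff_distrib)

lemma lin_compose: "lin S \<Longrightarrow> lin T \<Longrightarrow> lin (\<lambda>x. S (T x))"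
  using module_hom_compose[of scale scale T scale S] by (simp add: o_def)

lemma bop_id: "bop (\<lambda>x. x)" unfolding bop_def using lin_id by (auto intro!: exI[of _ 1])

lemma bop_proj: "closed_subspace V \<Longrightarrow> bop (proj V)"
  unfolding bop_def using lin_proj norm_proj by (auto intro!: exI[of _ 1])

lemma bop_diff: assumes "bop S" "bop T" shows "bop (\<lambda>x. S x - T x)"
proof -
  obtain C where C: "\<And>x. norm (S x) \<le> C * norm x" using bop_bound[OF assms(1)] by blast
  obtain D where D: "\<And>x. norm (T x) \<le> D * norm x" using bop_bound[OF assms(2)] by blast
  have "norm (S x - T x) \<le> (C + D) * norm x" for x
    using norm_triangle_ineq4[of "S x" "T x"] C[of x] D[of x] by (simp add: algebra_simps)
  then show ?thesis unfolding bop_def using lin_diff bop_lin assms by blast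
qed

text \<open>
  Limits in norm of operators of finite rank. On a Hilbert space these are the compact operators,
  but the definition makes it plain that they form an ideal.
\<close>

definition approximable :: "('a \<Rightarrow> 'a) \<Rightarrow> bool" where
  "approximable K \<longleftrightarrow> lin K \<and>
     (\<forall>\<epsilon>>0. \<exists>F. lin F \<and> finite_dim (range F) \<and> (\<forall>x. norm (K x - F x) \<le> \<epsilon> * norm x))"

lemma approximable_lin: "approximable K \<Longrightarrow> lin K" by (simp add: approximable_def)

lemma approximable_finite_rank: "lin F \<Longrightarrow> finite_dim (range F) \<Longrightarrow> approximable F"
  unfolding approximable_def by (auto intro!: exI[of _ F])

lemma finite_dim_sums: assumes "finite_dim V" "finite_dim W" shows "finite_dim (plus_space V W)"
proof -
  obtain B C where "finite B" "V \<subseteq> span B" "finite C" "W \<subseteq> span C"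
    using assms by (auto simp: finite_dim_def)
  then have "finite (B \<union> C)" "plus_space V W \<subseteq> span (B \<union> C)"
    using span_mono[of B "B \<union> C"] span_mono[of C "B \<union> C"] by (auto intro!: span_add)
  then show ?thesis unfolding finite_dim_def by blast
qed

lemma approximable_add:
  assumes "approximable K" "approximable L" shows "approximable (\<lambda>x. K x + L x)"
  unfolding approximable_def
proof (intro conjI allI impI)
  show "lin (\<lambda>x. K x + L x)" by (rule lin_add[OF approximable_lin[OF assms(1)] approximable_lin[OF assms(2)]])
  fix e :: real assume e: "e > 0"
  then obtain F G where F: "lin F" "finite_dim (range F)" "\<And>x. norm (K x - F x) \<le> e/2 * norm x"
    and G: "lin G" "finite_dim (range G)" "\<And>x. norm (L x - G x) \<le> e/2 * norm x"
    using assms unfolding approximable_def by (meson half_gt_zero)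
  have "range (\<lambda>x. F x + G x) \<subseteq> plus_space (range F) (range G)" by auto
  then have "finite_dim (range (\<lambda>x. F x + G x))" using finite_dim_mono[OF finite_dim_sums[OF F(2) G(2)]] by blast
  moreover have "norm (K x + L x - (F x + G x)) \<le> e * norm x" for x
    using norm_triangle_ineq[of "K x - F x" "L x - G x"] F(3)[of x] G(3)[of x]
    by (simp add: algebra_simps)
  ultimately show "\<exists>F. lin F \<and> finite_dim (range F) \<and> (\<forall>x. norm (K x + L x - F x) \<le> e * norm x)"
    using lin_add[OF F(1) G(1)] by blast
qed

lemma approximable_compose_left:
  assumes K: "approximable K" and T: "bop T" shows "approximable (\<lambda>x. T (K x))"
  unfolding approximable_def
proof (intro conjI allI impI)
  interpret T: module_hom scale scale T using T by (rule bop_lin)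
  show "lin (\<lambda>x. T (K x))" by (rule lin_compose[OF bop_lin[OF T] approximable_lin[OF K]])
  fix e :: real assume e: "e > 0"
  obtain C where C: "C > 0" "\<And>x. norm (T x) \<le> C * norm x" using bop_bound[OF T] by blast
  obtain F where F: "lin F" "finite_dim (range F)" "\<And>x. norm (K x - F x) \<le> e/C * norm x"
    using K e C(1) unfolding approximable_def by (meson divide_pos_pos)
  have "finite_dim (range (\<lambda>x. T (F x)))"
    using finite_dim_image[OF bop_lin[OF T] F(2)] by (simp add: image_image)
  moreover have "norm (T (K x) - T (F x)) \<le> e * norm x" for x
  proof -
    have "norm (T (K x) - T (F x)) \<le> C * norm (K x - F x)" using C(2)[of "K x - F x"] by (simp add: T.diff)
    also have "\<dots> \<le> C * (e/C * norm x)" using F(3) C(1) by (intro mult_left_mono) auto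
    finally show ?thesis using C(1) by simp
  qed
  ultimately show "\<exists>F. lin F \<and> finite_dim (range F) \<and> (\<forall>x. norm (T (K x) - F x) \<le> e * norm x)"
    using lin_compose[OF bop_lin[OF T] F(1)] by blast
qed

lemma approximable_compose_right:
  assumes K: "approximable K" and T: "bop T" shows "approximable (\<lambda>x. K (T x))"
  unfolding approximable_def
proof (intro conjI allI impI)
  show "lin (\<lambda>x. K (T x))" by (rule lin_compose[OF approximable_lin[OF K] bop_lin[OF T]])
  fix e :: real assume e: "e > 0"
  obtain C where C: "C > 0" "\<And>x. norm (T x) \<le> C * norm x" using bop_bound[OF T] by blast
  obtain F where F: "lin F" "finite_dim (range F)" "\<And>x. norm (K x - F x) \<le> e/C * norm x"
    using K e C(1) unfolding approximable_def by (meson divide_pos_pos)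
  have "range (\<lambda>x. F (T x)) \<subseteq> range F" by auto
  then have "finite_dim (range (\<lambda>x. F (T x)))" using finite_dim_mono[OF F(2)] by blast
  moreover have "norm (K (T x) - F (T x)) \<le> e * norm x" for x
  proof -
    have "norm (K (T x) - F (T x)) \<le> e/C * norm (T x)" by (rule F(3))
    also have "\<dots> \<le> e/C * (C * norm x)" using C e by (intro mult_left_mono) auto
    finally show ?thesis using C(1) by simp
  qed
  ultimately show "\<exists>F. lin F \<and> finite_dim (range F) \<and> (\<forall>x. norm (K (T x) - F x) \<le> e * norm x)"
    using lin_compose[OF F(1) bop_lin[OF T]] by blast
qed

lemma approximable_minus: "approximable K \<Longrightarrow> approximable (\<lambda>x. - K x)"
  using approximable_compose_left[of K "\<lambda>x. - x"] bop_id lin_diff[OF _ lin_id, of "\<lambda>x. 0"]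
  by (auto simp: bop_def module_hom_iff intro!: exI[of _ 1])

text \<open>
  Cover the image of the unit ball by finitely many balls of radius \<open>\<epsilon>\<close> and compose \<open>K\<close> with the projection
  onto the span of their centres: every point of the image is within \<open>\<epsilon>\<close> of that span.
\<close>

lemma approximable_compact:
  assumes K: "lin K" and cpt: "compact (closure (K ` cball 0 1))" shows "approximable K"
  unfolding approximable_def
proof (intro conjI allI impI)
  interpret K: module_hom scale scale K by fact
  fix e :: real assume e: "e > 0"
  obtain S where S: "finite S" "closure (K ` cball 0 1) \<subseteq> (\<Union>c\<in>S. ball c e)"
    using cpt e unfolding compact_eq_totally_bounded by blast
  define P where "P = proj (span S)"
  have cs: "closed_subspace (span S)" by (rule closed_subspace_span_finite[OF S(1)])
  interpret P: module_hom scale scale P unfolding P_def by (rule lin_proj[OF cs])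
  have "finite_dim (range (\<lambda>x. P (K x)))"
    unfolding finite_dim_def P_def using S(1) proj_mem[OF cs] by blast
  moreover have "norm (K x - P (K x)) \<le> e * norm x" for x
  proof (cases "x = 0")
    case False
    define y where "y = scale (of_real (1 / norm x)) x"
    have yn: "y = (1 / norm x) *\<^sub>R x" unfolding y_def by (rule scale_of_real)
    have "K y \<in> closure (K ` cball 0 1)" using False closure_subset by (force simp: yn)
    then obtain c where c: "c \<in> S" "dist c (K y) < e" using S(2) by auto
    have "P c = c" unfolding P_def using c by (intro proj_id cs span_base)
    then have eq: "K y - P (K y) = (K y - c) - P (K y - c)" by (simp add: P.diff)
    have "norm (K y - P (K y)) \<le> norm (K y - c)" unfolding eq unfolding P_def by (rule norm_proj(2)[OF cs])
    then have 1: "norm (K y - P (K y)) \<le> e" using c by (simp add: dist_norm norm_minus_commute)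
    have "K y - P (K y) = scale (of_real (1 / norm x)) (K x - P (K x))"
      unfolding y_def by (simp add: K.scale P.scale scale_right_diff_distrib)
    then have "norm (K y - P (K y)) = norm (K x - P (K x)) / norm x" unfolding scale_of_real by simp
    then show ?thesis using mult_left_mono[OF 1, of "norm x"] False by (simp add: field_simps)
  qed (simp add: K.zero P.zero)
  ultimately show "\<exists>F. lin F \<and> finite_dim (range F) \<and> (\<forall>x. norm (K x - F x) \<le> e * norm x)"
    using lin_compose[OF P.module_hom_axioms K] by blast
qed (rule K)

section \<open>Stability of the index under compact perturbations\<close>

text \<open>
  Write \<open>K = F + L\<close> with \<open>F\<close> of finite rank and \<open>norm L \<le> 1/2\<close>. The operator \<open>1 + L\<close>, with \<open>L\<close> compressed to \<open>X\<close>, is a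
  bijection of \<open>X\<close> by the contraction principle and agrees with \<open>T\<close> on \<open>X0 = X \<inter> ker F\<close>. A bijection of \<open>X\<close>
  preserves the codimension of \<open>X0\<close>, so the index is 0.
\<close>

lemma fredholm_index_id_plus:
  assumes X: "closed_subspace X" and T: "lin T" "T ` X \<subseteq> X"
    and K: "approximable K" and TK: "\<And>x. x \<in> X \<Longrightarrow> T x = x + K x"
  shows "fredholm_index T X X 0"
proof -
  have sX: "subspace X" and cX: "complete X" using X by (auto simp: closed_subspace_def complete_eq_closed)
  obtain F where F: "lin F" "finite_dim (range F)" "\<And>x. norm (K x - F x) \<le> 1/2 * norm x"
    using K unfolding approximable_def by (meson half_gt_zero zero_less_one)
  \<comment> \<open>\<open>K - F\<close> is projected back to \<open>X\<close>; where \<open>F\<close> vanishes, \<open>K\<close> maps into \<open>X\<close> and the projection does nothing\<close>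
  define R where "R x = proj X (K x - F x)" for x
  define S where "S x = x + R x" for x
  have linR: "lin R" unfolding R_def
    by (rule lin_compose[OF lin_proj[OF X] lin_diff[OF approximable_lin[OF K] F(1)]])
  then interpret R: module_hom scale scale R .
  have linS: "lin S" unfolding S_def by (rule lin_add[OF lin_id linR])
  have Rn: "norm (R x) \<le> 1/2 * norm x" for x
    unfolding R_def by (rule order.trans[OF norm_proj(1)[OF X] F(3)])
  have fixp: "\<exists>!x\<in>X. y - R x = x" if y: "y \<in> X" for y
  proof (rule Banach_fix[OF cX, where c = "1/2"])
    show "X \<noteq> {}" using y by auto
    show "(\<lambda>x. y - R x) ` X \<subseteq> X" using y proj_mem[OF X] by (auto simp: R_def intro!: subspace_diff[OF sX])
    show "dist (y - R x) (y - R z) \<le> 1/2 * dist x z" for x z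
      using Rn[of "x - z"] by (simp add: dist_norm R.diff norm_minus_commute)
  qed auto
  have SX: "S x \<in> X" if "x \<in> X" for x
    unfolding S_def R_def by (rule subspace_add[OF sX that proj_mem[OF X]])
  have inj: "inj_on S X"
  proof (rule inj_onI)
    fix x z assume xz: "x \<in> X" "z \<in> X" "S x = S z"
    have "S x - R x = x" by (simp add: S_def)
    moreover have "S x - R z = z" unfolding xz(3) by (simp add: S_def)
    ultimately show "x = z" using fixp[OF SX[OF xz(1)]] xz by blast
  qed
  have surj: "S ` X = X"
  proof
    show "X \<subseteq> S ` X"
    proof
      fix y assume "y \<in> X"
      then obtain x where x: "x \<in> X" "y - R x = x" using fixp by blast
      then have "y = S x" unfolding S_def by (metis diff_add_cancel)
      then show "y \<in> S ` X" using x by blast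
    qed
  qed (use SX in auto)
  define X0 where "X0 = {x\<in>X. F x = 0}"
  obtain n where n: "has_codim X X0 n" unfolding X0_def
    using has_codim_kernel[OF F(1) sX finite_dim_mono[OF F(2)]] by blast
  have TS: "T x = S x" if "x \<in> X0" for x
  proof -
    have x: "x \<in> X" "F x = 0" using that by (auto simp: X0_def)
    have "K x = T x - x" using TK[OF x(1)] by simp
    then have "K x \<in> X" using x T subspace_diff[OF sX, of "T x" x] by auto
    then show ?thesis using x TK by (simp add: S_def R_def proj_id[OF X])
  qed
  have im: "T ` X0 = S ` X0" by (rule image_cong[OF refl TS])
  have injT: "inj_on T X0 \<longleftrightarrow> inj_on S X0" by (rule inj_on_cong) (rule TS)
  have "has_codim X (S ` X0) n" using has_codim_image_inj[OF linS n inj] surj by simp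
  moreover have "inj_on S X0" by (rule inj_on_subset[OF inj]) (auto simp: X0_def)
  ultimately have "index_on T X X X0 0" unfolding index_on_def im injT using n by force
  then show ?thesis unfolding fredholm_index_def using T by blast
qed

lemma finite_dim_subspace_closed:
  assumes "subspace V" "finite_dim V" shows "closed_subspace V"
proof -
  obtain n where n: "has_codim V {0} n" using finite_dim_has_codim_0[OF assms] by blast
  obtain B where B: "finite B" "B \<subseteq> V" "V \<subseteq> span ({0} \<union> B)" using has_codim_span[OF n] by blast
  then have "V = span B" using span_minimal[OF B(2) assms(1)] by (auto simp: span_insert_0)
  then show ?thesis using closed_subspace_span_finite[OF B(1)] by simp
qed

lemma closed_subspace_Int: "closed_subspace V \<Longrightarrow> closed_subspace W \<Longrightarrow> closed_subspace (V \<inter> W)"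
  unfolding closed_subspace_def by (auto intro: subspace_inter)

text \<open>
  A Fredholm operator has a bounded inverse up to finite rank. Let \<open>M1\<close> be the complement of the
  kernel \<open>Z\<close> and \<open>B\<close> a basis of \<open>N\<close> modulo the range; then \<open>(x, v) \<mapsto> D x + v\<close> is a bounded bijection
  from \<open>M1 \<times> span B\<close> to \<open>N\<close>, and the open mapping theorem bounds its inverse. The operator \<open>E\<close> is the
  first component of that inverse.
\<close>

lemma fredholm_parametrix:
  assumes D: "fredholm_index D M N i" "bop D" and M: "closed_subspace M" and N: "closed_subspace N"
  shows "\<exists>E K L. bop E \<and> range E \<subseteq> M \<and> approximable K \<and> approximable L \<and>
    (\<forall>y\<in>N. D (E y) = y + K y) \<and> (\<forall>x\<in>M. E (D x) = x + L x)"
proof -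
  interpret D: module_hom scale scale D using D(2) by (rule bop_lin)
  interpret DB: bounded_linear D by (rule bop_bounded_linear[OF D(2)])
  have sM: "subspace M" and sN: "subspace N" using M N by (auto simp: closed_subspace_def)
  have DM: "D ` M \<subseteq> N" using D by (auto simp: fredholm_index_def)
  obtain M0 m n where M0: "inj_on D M0" "has_codim M M0 m" "has_codim N (D ` M0) n"
    using D(1) by (auto simp: fredholm_index_def index_on_def)
  define Z where "Z = {x\<in>M. D x = 0}"
  have sZ: "subspace Z" unfolding Z_def using sM by (auto simp: subspace_def D.add D.scale D.zero)
  have "x = 0" if "x \<in> Z \<inter> M0" for x
    using inj_onD[OF M0(1), of x 0] that subspace_0[OF has_codim_subspace(2)[OF M0(2)]] by (auto simp: Z_def D.zero)
  then have "Z \<inter> M0 = {0}" using subspace_0[OF sZ] subspace_0[OF has_codim_subspace(2)[OF M0(2)]] by auto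
  moreover obtain k where "has_codim Z (Z \<inter> M0) k"
    using has_codim_Int[OF M0(2) sZ] by (auto simp: Z_def)
  ultimately have finZ: "finite_dim Z" using has_codim_0_finite_dim by simp
  have Z: "closed_subspace Z" by (rule finite_dim_subspace_closed[OF sZ finZ])
  define M1 where "M1 = M \<inter> orth Z"
  have M1: "closed_subspace M1" unfolding M1_def
    by (rule closed_subspace_Int[OF M closed_subspace_orth[OF sZ]])
  have sM1: "subspace M1" using M1 by (simp add: closed_subspace_def)
  have split: "x - proj Z x \<in> M1" "D (x - proj Z x) = D x" if "x \<in> M" for x
    using that proj_mem[OF Z, of x] proj_orth[OF Z, of x] subspace_diff[OF sM]
    by (auto simp: M1_def Z_def D.diff)
  have DM1: "D ` M1 = D ` M"
  proof
    show "D ` M \<subseteq> D ` M1" using split by (metis image_eqI image_subsetI)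
  qed (auto simp: M1_def)
  have D0: "x = 0" if "x \<in> M1" "D x = 0" for x
    using that orth_disjoint[of x Z] by (auto simp: M1_def Z_def)
  have sDM: "subspace (D ` M1)" by (rule D.subspace_image[OF sM1])
  have "D ` M0 \<subseteq> D ` M1" unfolding DM1 using has_codim_subspace(3)[OF M0(2)] by auto
  then obtain b where "has_codim N (D ` M1) b"
    using has_codim_between(1)[OF M0(3) sDM] DM1 DM by auto
  then obtain B where B: "quot_basis N (D ` M1) B" by (auto simp: has_codim_def)
  have finB: "finite B" and BN: "B \<subseteq> N" using B by (auto simp: quot_basis_def)
  have BDM: "y = 0" if "y \<in> span B" "y \<in> D ` M1" for y
  proof -
    have "y \<in> range (\<lambda>u. \<Sum>v\<in>B. scale (u v) v)" using that(1) unfolding span_finite[OF finB] .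
    then obtain a where a: "y = (\<Sum>v\<in>B. scale (a v) v)" by blast
    have "a v = 0" if "v \<in> B" for v using quot_basis_coeff_0[OF B, of a v] that \<open>y \<in> D ` M1\<close> a by simp
    then show ?thesis by (simp add: a)
  qed
  have spB: "closed_subspace (span B)" by (rule closed_subspace_span_finite[OF finB])
  have spBN: "span B \<subseteq> N" using span_minimal[OF BN sN] .
  \<comment> \<open>the open mapping theorem is applied on the product, so that \<open>D\<close> need not be surjective\<close>
  define f where "f z = D (fst z) + snd z" for z :: "'a \<times> 'a"
  have "\<exists>C. \<forall>y\<in>N. \<exists>z\<in>M1 \<times> span B. f z = y \<and> norm z \<le> C * norm y"
  proof (rule open_mapping_estimate)
    show "bounded_linear f" unfolding f_def
      by (intro bounded_linear_add bounded_linear_compose[OF DB.bounded_linear_axioms] bounded_linear_fst bounded_linear_snd)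
    show "real_vector.subspace (M1 \<times> span B)"
      using real_subspace[OF sM1] real_subspace[OF subspace_span[of B]]
      by (auto simp: real_vector.subspace_def zero_prod_def)
    show "closed (M1 \<times> span B)" using M1 spB by (auto simp: closed_subspace_def intro: closed_Times)
    show "real_vector.subspace N" "closed N" using N real_subspace by (auto simp: closed_subspace_def)
    show "f ` (M1 \<times> span B) = N"
    proof
      show "f ` (M1 \<times> span B) \<subseteq> N" using DM[folded DM1] spBN by (fastforce simp: f_def intro!: subspace_add[OF sN])
      show "N \<subseteq> f ` (M1 \<times> span B)"
      proof
        fix y assume "y \<in> N"
        moreover have "\<forall>y\<in>N. \<exists>a. y - (\<Sum>v\<in>B. scale (a v) v) \<in> D ` M1" using B by (simp add: quot_basis_def)
        ultimately obtain a where "y - (\<Sum>v\<in>B. scale (a v) v) \<in> D ` M1" by blast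
        then obtain x where x: "x \<in> M1" "y - (\<Sum>v\<in>B. scale (a v) v) = D x" by auto
        have "(\<Sum>v\<in>B. scale (a v) v) \<in> span B" by (intro span_sum span_scale span_base)
        moreover have "y = f (x, \<Sum>v\<in>B. scale (a v) v)" using x by (simp add: f_def algebra_simps)
        ultimately show "y \<in> f ` (M1 \<times> span B)" using x by blast
      qed
    qed
  qed
  then obtain C where C: "\<And>y. y \<in> N \<Longrightarrow> \<exists>z\<in>M1 \<times> span B. f z = y \<and> norm z \<le> C * norm y" by blast
  define E where "E y = (SOME x. x \<in> M1 \<and> proj N y - D x \<in> span B \<and> norm x \<le> C * norm (proj N y))" for y
  have E: "E y \<in> M1 \<and> proj N y - D (E y) \<in> span B \<and> norm (E y) \<le> C * norm (proj N y)" for y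
    unfolding E_def
  proof (rule someI_ex)
    obtain x v where xv: "x \<in> M1" "v \<in> span B" "D x + v = proj N y" "norm (x, v) \<le> C * norm (proj N y)"
      using C[OF proj_mem[OF N, of y]] by (auto simp: f_def)
    have "proj N y - D x \<in> span B" using xv by (metis add_diff_cancel_left')
    moreover have "norm x \<le> C * norm (proj N y)" using xv(4) norm_fst_le[of x v] by simp
    ultimately show "\<exists>x. x \<in> M1 \<and> proj N y - D x \<in> span B \<and> norm x \<le> C * norm (proj N y)" using xv by blast
  qed
  have E1: "E y \<in> M1" and E2: "proj N y - D (E y) \<in> span B" for y using E by auto
  have uniq: "E y = x" if x: "x \<in> M1" "proj N y - D x \<in> span B" for x y
  proof -
    have "(proj N y - D x) - (proj N y - D (E y)) \<in> span B" by (rule span_diff[OF x(2) E2])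
    then have "D (E y - x) \<in> span B" by (simp add: D.diff)
    moreover have "E y - x \<in> M1" by (rule subspace_diff[OF sM1 E1 x(1)])
    ultimately show ?thesis using BDM D0 by fastforce
  qed
  interpret P: module_hom scale scale "proj N" by (rule lin_proj[OF N])
  have linE: "lin E" unfolding module_hom_iff
  proof (intro conjI allI module_axioms)
    fix x y
    show "E (x + y) = E x + E y"
    proof (rule uniq)
      have "(proj N x - D (E x)) + (proj N y - D (E y)) \<in> span B" by (rule span_add[OF E2 E2])
      then show "proj N (x + y) - D (E x + E y) \<in> span B" by (simp add: P.add D.add algebra_simps)
    qed (rule subspace_add[OF sM1 E1 E1])
  next
    fix c x
    show "E (scale c x) = scale c (E x)"
    proof (rule uniq)
      have "scale c (proj N x - D (E x)) \<in> span B" by (rule span_scale[OF E2])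
      then show "proj N (scale c x) - D (scale c (E x)) \<in> span B"
        by (simp add: P.scale D.scale scale_right_diff_distrib)
    qed (rule subspace_scale[OF sM1 E1])
  qed
  have "norm (E y) \<le> \<bar>C\<bar> * norm y" for y
  proof -
    have "norm (E y) \<le> C * norm (proj N y)" using E by blast
    also have "\<dots> \<le> \<bar>C\<bar> * norm (proj N y)" by (intro mult_right_mono) auto
    also have "\<dots> \<le> \<bar>C\<bar> * norm y" by (intro mult_left_mono norm_proj[OF N]) auto
    finally show ?thesis .
  qed
  then have bE: "bop E" unfolding bop_def using linE by blast
  define K where "K y = D (E y) - proj N y" for y
  define L where "L x = - proj Z x" for x
  have "lin K" unfolding K_def by (rule lin_diff[OF lin_compose[OF bop_lin[OF D(2)] linE] lin_proj[OF N]])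
  moreover have "range K \<subseteq> span B"
  proof
    fix z assume "z \<in> range K"
    then obtain y where "z = - (proj N y - D (E y))" by (auto simp: K_def)
    then show "z \<in> span B" using span_neg[OF E2[of y]] by simp
  qed
  ultimately have K: "approximable K"
    using finB approximable_finite_rank unfolding finite_dim_def by blast
  have "approximable (proj Z)"
    by (rule approximable_finite_rank[OF lin_proj[OF Z]], rule finite_dim_mono[OF finZ])
      (use proj_mem[OF Z] in auto)
  then have L: "approximable L" unfolding L_def by (rule approximable_minus)
  have "E (D x) = x + L x" if x: "x \<in> M" for x
  proof -
    have "D x \<in> N" using DM x by auto
    then have "proj N (D x) - D (x - proj Z x) = 0" using split(2)[OF x] proj_id[OF N] by simp
    then have "E (D x) = x - proj Z x" using split(1)[OF x] span_zero by (intro uniq) auto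
    then show ?thesis by (simp add: L_def)
  qed
  moreover have "D (E y) = y + K y" if "y \<in> N" for y using proj_id[OF N that] by (simp add: K_def)
  moreover have "range E \<subseteq> M" using E by (auto simp: M1_def)
  ultimately show ?thesis using bE K L by blast
qed

text \<open>
  For a parametrix \<open>E\<close> of \<open>T\<close> both \<open>E T\<close> and \<open>E S\<close> are compact perturbations of the identity, so \<open>T\<close> and \<open>S\<close>
  both have the index opposite to that of \<open>E\<close>.
\<close>

lemma fredholm_index_perturbation:
  assumes T: "fredholm_index T X Y i" "bop T" and S: "fredholm_index S X Y j"
    and X: "closed_subspace X" and Y: "closed_subspace Y"
    and K: "approximable K" "\<And>x. x \<in> X \<Longrightarrow> S x = T x + K x"
  shows "i = j"
proof -
  obtain E K1 K2 where E: "bop E" "range E \<subseteq> X" and K1: "approximable K1" and K2: "approximable K2"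
    and TE: "\<And>y. y \<in> Y \<Longrightarrow> T (E y) = y + K1 y" and ET: "\<And>x. x \<in> X \<Longrightarrow> E (T x) = x + K2 x"
    using fredholm_parametrix[OF T X Y] by blast
  interpret E: module_hom scale scale E using E(1) by (rule bop_lin)
  have lT: "lin T" "T ` X \<subseteq> Y" and lS: "lin S" "S ` X \<subseteq> Y" using T S by (auto simp: fredholm_index_def)
  have 1: "fredholm_index (E \<circ> T) X X 0"
    by (rule fredholm_index_id_plus[OF X module_hom_compose[OF lT(1) bop_lin[OF E(1)]] _ K2],
      (use E(2) in auto)[1], (use ET in auto)[1])
  have 2: "fredholm_index (T \<circ> E) Y Y 0"
    by (rule fredholm_index_id_plus[OF Y module_hom_compose[OF bop_lin[OF E(1)] lT(1)] _ K1],
      (use E(2) lT(2) in auto)[1], (use TE in auto)[1])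
  have "E ` Y \<subseteq> X" using E by auto
  then obtain e where e: "fredholm_index E Y X e"
    using fredholm_index_factor[OF bop_lin[OF E(1)] _ lT 2 1] by blast
  have "approximable (\<lambda>x. K2 x + E (K x))"
    by (rule approximable_add[OF K2 approximable_compose_left[OF K(1) E(1)]])
  then have "fredholm_index (E \<circ> S) X X 0"
    by (rule fredholm_index_id_plus[OF X module_hom_compose[OF lS(1) bop_lin[OF E(1)]], rotated],
      (use E(2) in auto)[2], (use ET K(2) in \<open>auto simp: E.add\<close>)[1])
  then have "j + e = 0" using fredholm_index_compose[OF S e] fredholm_index_unique by blast
  moreover have "i + e = 0" using fredholm_index_compose[OF T(1) e] 1 fredholm_index_unique by blast
  ultimately show ?thesis by simp
qed

section \<open>The index of a projection between two nearby subspaces\<close>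

lemma proj_complement:
  assumes H: "closed_subspace H" and N: "closed_subspace N" and NH: "N \<subseteq> H" and x: "x \<in> H"
  shows "proj (H \<inter> orth N) x = x - proj N x"
proof (rule proj_unique)
  have s: "subspace H" "subspace N" using H N by (auto simp: closed_subspace_def)
  show "closed_subspace (H \<inter> orth N)" by (rule closed_subspace_Int[OF H closed_subspace_orth[OF s(2)]])
  show "x - proj N x \<in> H \<inter> orth N"
    using proj_mem[OF N, of x] proj_orth[OF N, of x] NH x subspace_diff[OF s(1)] by blast
  show "x - (x - proj N x) \<in> orth (H \<inter> orth N)"
    using proj_mem[OF N, of x] by (auto simp: orth_def inner_commute)
qed

lemma plus_space_complement:
  assumes H: "closed_subspace H" and N: "closed_subspace N" and NH: "N \<subseteq> H"
  shows "plus_space N (H \<inter> orth N) = H"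
proof (intro subset_antisym subsetI)
  have s: "subspace H" using H by (simp add: closed_subspace_def)
  fix x
  show "x \<in> plus_space N (H \<inter> orth N) \<Longrightarrow> x \<in> H" using NH by (auto intro: subspace_add[OF s])
  assume "x \<in> H"
  then have "x - proj N x \<in> H \<inter> orth N" using proj_mem[OF N, of x] proj_orth[OF N, of x] NH subspace_diff[OF s] by blast
  moreover have "x = proj N x + (x - proj N x)" by simp
  ultimately show "x \<in> plus_space N (H \<inter> orth N)" using proj_mem[OF N] by blast
qed

text \<open>
  The hypotheses say that each of \<open>N\<close> and \<open>N'\<close> is compactly close to the other. The projections
  between them, and likewise between their complements, are then inverse to each other up to compact
  operators, hence Fredholm. That the two indices are opposite is read off the block
  triangular operator \<open>T\<close> below.
\<close>

lemma projection_index: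
  assumes H: "closed_subspace H" and N: "closed_subspace N" "N \<subseteq> H" and N': "closed_subspace N'" "N' \<subseteq> H"
    and K: "approximable K" "\<And>z. z \<in> N' \<Longrightarrow> z = proj N z + K z"
    and K': "approximable K'" "\<And>z. z \<in> N \<Longrightarrow> z = proj N' z + K' z"
  shows "\<exists>a. fredholm_index (proj N') N N' a \<and>
    fredholm_index (proj (H \<inter> orth N')) (H \<inter> orth N) (H \<inter> orth N') (- a)"
proof -
  define M where "M = H \<inter> orth N"
  define M' where "M' = H \<inter> orth N'"
  have s: "subspace H" "subspace N" "subspace N'" using H N N' by (auto simp: closed_subspace_def)
  have M: "closed_subspace M" "M \<subseteq> H" and M': "closed_subspace M'" "M' \<subseteq> H"
    unfolding M_def M'_def using closed_subspace_Int[OF H closed_subspace_orth] s by auto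
  have PM: "proj M x = x - proj N x" and PM': "proj M' x = x - proj N' x" if "x \<in> H" for x
    unfolding M_def M'_def using proj_complement[OF H N that] proj_complement[OF H N' that] by auto
  interpret P: module_hom scale scale "proj N" by (rule lin_proj[OF N(1)])
  interpret P': module_hom scale scale "proj N'" by (rule lin_proj[OF N'(1)])
  interpret Q: module_hom scale scale "proj M" by (rule lin_proj[OF M(1)])
  interpret Q': module_hom scale scale "proj M'" by (rule lin_proj[OF M'(1)])
  have PK: "proj N z = z - K z" if "z \<in> N'" for z using K(2)[OF that] by (metis add_diff_cancel_right')
  have PK': "proj N' z = z - K' z" if "z \<in> N" for z using K'(2)[OF that] by (metis add_diff_cancel_right')
  have lin2: "lin (proj A \<circ> proj B)" if "closed_subspace A" "closed_subspace B" for A B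
    using module_hom_compose[OF lin_proj[OF that(2)] lin_proj[OF that(1)]] .
  have "fredholm_index (proj N \<circ> proj N') N N 0"
    by (rule fredholm_index_id_plus[OF N(1) lin2[OF N(1) N'(1)] _
          approximable_minus[OF approximable_compose_left[OF K'(1) bop_proj[OF N(1)]]]])
      ((use proj_mem[OF N(1)] in auto)[1], (auto simp: PK' P.diff proj_id[OF N(1)])[1])
  moreover have "fredholm_index (proj N' \<circ> proj N) N' N' 0"
    by (rule fredholm_index_id_plus[OF N'(1) lin2[OF N'(1) N(1)] _
          approximable_minus[OF approximable_compose_left[OF K(1) bop_proj[OF N'(1)]]]])
      ((use proj_mem[OF N'(1)] in auto)[1], (auto simp: PK P'.diff proj_id[OF N'(1)])[1])
  ultimately obtain a where a: "fredholm_index (proj N') N N' a"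
    using fredholm_index_factor[OF lin_proj[OF N'(1)] _ lin_proj[OF N(1)]] proj_mem[OF N(1)] proj_mem[OF N'(1)]
    by (metis image_subsetI)
  have QQ': "proj M (proj M' w) = w + - K (proj N' w)" if "w \<in> M" for w
  proof -
    have y: "proj N' w \<in> N'" by (rule proj_mem[OF N'(1)])
    have "proj M (proj M' w) = proj M w - proj M (proj N' w)" using that M by (auto simp: PM' Q.diff)
    also have "\<dots> = w - K (proj N' w)"
      using proj_id[OF M(1) that] PM[of "proj N' w"] PK[OF y] y N' by auto
    finally show ?thesis by simp
  qed
  have Q'Q: "proj M' (proj M w) = w + - K' (proj N w)" if "w \<in> M'" for w
  proof -
    have y: "proj N w \<in> N" by (rule proj_mem[OF N(1)])
    have "proj M' (proj M w) = proj M' w - proj M' (proj N w)" using that M' by (auto simp: PM Q'.diff)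
    also have "\<dots> = w - K' (proj N w)"
      using proj_id[OF M'(1) that] PM'[of "proj N w"] PK'[OF y] y N by auto
    finally show ?thesis by simp
  qed
  have "fredholm_index (proj M \<circ> proj M') M M 0"
    by (rule fredholm_index_id_plus[OF M(1) lin2[OF M(1) M'(1)] _
          approximable_minus[OF approximable_compose_right[OF K(1) bop_proj[OF N'(1)]]]])
      ((use proj_mem[OF M(1)] in auto)[1], (auto simp: QQ')[1])
  moreover have "fredholm_index (proj M' \<circ> proj M) M' M' 0"
    by (rule fredholm_index_id_plus[OF M'(1) lin2[OF M'(1) M(1)] _
          approximable_minus[OF approximable_compose_right[OF K'(1) bop_proj[OF N(1)]]]])
      ((use proj_mem[OF M'(1)] in auto)[1], (auto simp: Q'Q)[1])
  ultimately obtain c where c: "fredholm_index (proj M') M M' c"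
    using fredholm_index_factor[OF lin_proj[OF M'(1)] _ lin_proj[OF M(1)]] proj_mem[OF M(1)] proj_mem[OF M'(1)]
    by (metis image_subsetI)
  \<comment> \<open>its diagonal blocks are \<open>proj N'\<close> from \<open>N\<close> to \<open>N'\<close> and \<open>proj M'\<close> from \<open>M\<close> to \<open>M'\<close>, and on \<open>N\<close> it has no component in \<open>M'\<close>; as it changes only the \<open>N\<close>-component, and that by a compact operator, it is the identity plus a compact operator\<close>
  define T where "T x = proj N' (proj N x) + proj M x" for x
  have linT: "lin T" unfolding T_def
    by (rule lin_add[OF lin_compose[OF lin_proj[OF N'(1)] lin_proj[OF N(1)]] lin_proj[OF M(1)]])
  have TN: "T x = proj N' x" if "x \<in> N" for x
    using that N by (auto simp: T_def PM proj_id[OF N(1)])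
  have TM: "T x = x" if "x \<in> M" for x
  proof -
    have "proj N x = 0" using proj_0[OF N(1)] that by (simp add: M_def)
    then show ?thesis using proj_id[OF M(1) that] by (simp add: T_def P'.zero)
  qed
  have "fredholm_index T (plus_space N M) (plus_space N' M') (a + c)"
  proof (rule fredholm_index_triangular[OF linT lin_proj[OF M'(1)]])
    show "proj M' y = 0" if "y \<in> N'" for y using that N' by (auto simp: PM' proj_id[OF N'(1)])
    show "proj M' y = y" if "y \<in> M'" for y by (rule proj_id[OF M'(1) that])
    show "N \<inter> M \<subseteq> {0}" using orth_disjoint by (auto simp: M_def)
    show "T x - proj M' (T x) \<in> N'" if "x \<in> M" for x
      using that M proj_mem[OF N'(1)] by (auto simp: TM PM')
    show "fredholm_index T N N' a" by (rule fredholm_index_cong[OF a linT]) (simp add: TN)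
    show "fredholm_index (proj M' \<circ> T) M M' c"
      by (rule fredholm_index_cong[OF c module_hom_compose[OF linT lin_proj[OF M'(1)]]]) (simp add: TM)
  qed
  then have "fredholm_index T H H (a + c)"
    using plus_space_complement[OF H N] plus_space_complement[OF H N'] by (simp add: M_def M'_def)
  moreover have "fredholm_index T H H 0"
  proof (rule fredholm_index_id_plus[OF H linT _ approximable_minus[OF approximable_compose_right[OF K'(1) bop_proj[OF N(1)]]]])
    show "T ` H \<subseteq> H" using proj_mem[OF N'(1)] proj_mem[OF M(1)] N' M by (auto simp: T_def intro!: subspace_add[OF s(1)])
    show "T x = x + - K' (proj N x)" if "x \<in> H" for x
      using PK'[OF proj_mem[OF N(1)]] PM[OF that] by (simp add: T_def)
  qed
  ultimately have "a + c = 0" using fredholm_index_unique by blast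
  then have "c = - a" by simp
  then show ?thesis using a c unfolding M_def M'_def by blast
qed

section \<open>Chains of operators and their reduced maps\<close>

text \<open>
  Sequences of spaces whose maps are defined on all of \<open>'a\<close>. Every sequence of spaces and maps
  is brought into this form without changing null spaces and ranges (\<open>op_chain_extension\<close>).
\<close>

definition op_chain :: "(int \<Rightarrow> 'a set) \<Rightarrow> (int \<Rightarrow> 'a \<Rightarrow> 'a) \<Rightarrow> bool" where
  "op_chain H d \<longleftrightarrow> (\<forall>p. closed_subspace (H p) \<and> bop (d p) \<and> (\<forall>x. d p x \<in> H (p - 1)))"

text \<open>
  The orthogonal complement of the null space, a closed copy of \<open>H p\<close> modulo the null space.
\<close>

definition coimage :: "(int \<Rightarrow> 'a set) \<Rightarrow> (int \<Rightarrow> 'a \<Rightarrow> 'a) \<Rightarrow> int \<Rightarrow> 'a set" where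
  "coimage H d p = H p \<inter> orth (null_space H d p)"

definition reduced_map :: "(int \<Rightarrow> 'a set) \<Rightarrow> (int \<Rightarrow> 'a \<Rightarrow> 'a) \<Rightarrow> int \<Rightarrow> 'a \<Rightarrow> 'a" where
  "reduced_map H d p x = proj (null_space H d (p - 1)) (d p x)"

lemma op_chainD:
  assumes "op_chain H d"
  shows "closed_subspace (H p)" "bop (d p)" "d p x \<in> H (p - 1)"
  using assms by (auto simp: op_chain_def)

lemma closed_subspace_null_space:
  assumes c: "op_chain H d" shows "closed_subspace (null_space H d p)"
proof -
  interpret d: module_hom scale scale "d p" by (rule bop_lin[OF op_chainD(2)[OF c]])
  interpret b: bounded_linear "d p" by (rule bop_bounded_linear[OF op_chainD(2)[OF c]])
  have "closed {x. d p x = 0}"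
    by (intro closed_Collect_eq continuous_on_const b.continuous_on continuous_on_id)
  moreover have "null_space H d p = H p \<inter> {x. d p x = 0}" by (auto simp: null_space_def)
  moreover have "subspace {x. d p x = 0}" by (auto simp: subspace_def d.add d.scale d.zero)
  ultimately show ?thesis
    using op_chainD(1)[OF c, of p] closed_subspace_Int[of "H p" "{x. d p x = 0}"] by (simp add: closed_subspace_def)
qed

lemma null_space_subset: "null_space H d p \<subseteq> H p"
  by (auto simp: null_space_def)

lemma closed_subspace_coimage:
  assumes c: "op_chain H d" shows "closed_subspace (coimage H d p)"
  unfolding coimage_def
  by (rule closed_subspace_Int[OF op_chainD(1)[OF c] closed_subspace_orth])
    (use closed_subspace_null_space[OF c] in \<open>simp add: closed_subspace_def\<close>)

lemma subspace_range_space: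
  assumes c: "op_chain H d" shows "subspace (range_space H d p)"
  using module_hom.subspace_image[OF bop_lin[OF op_chainD(2)[OF c]]] op_chainD(1)[OF c, of p]
  unfolding range_space_def closed_subspace_def by blast

lemma bop_reduced_map: assumes "op_chain H d" shows "bop (reduced_map H d p)"
  unfolding reduced_map_def
  by (rule bop_compose[OF bop_proj[OF closed_subspace_null_space[OF assms]] op_chainD(2)[OF assms]])

lemma coimage_decomposition:
  assumes c: "op_chain H d" and x: "x \<in> H p"
  shows "x - proj (null_space H d p) x \<in> coimage H d p"
    and "d p (x - proj (null_space H d p) x) = d p x"
proof -
  interpret d: module_hom scale scale "d p" by (rule bop_lin[OF op_chainD(2)[OF c]])
  have N: "proj (null_space H d p) x \<in> null_space H d p" "x - proj (null_space H d p) x \<in> orth (null_space H d p)"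
    using proj_mem_orth[OF closed_subspace_null_space[OF c]] by auto
  have "subspace (H p)" using op_chainD(1)[OF c] by (simp add: closed_subspace_def)
  then show "x - proj (null_space H d p) x \<in> coimage H d p"
    using N x subspace_diff unfolding coimage_def null_space_def by blast
  show "d p (x - proj (null_space H d p) x) = d p x" using N(1) by (simp add: d.diff null_space_def)
qed

lemma inj_on_coimage:
  assumes c: "op_chain H d" shows "inj_on (d p) (coimage H d p)"
proof -
  interpret d: module_hom scale scale "d p" by (rule bop_lin[OF op_chainD(2)[OF c]])
  have "subspace (coimage H d p)" using closed_subspace_coimage[OF c] by (simp add: closed_subspace_def)
  moreover have "x = 0" if "x \<in> coimage H d p" "d p x = 0" for x
    using that orth_disjoint[of x "null_space H d p"] by (auto simp: coimage_def null_space_def)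
  ultimately show ?thesis using d.inj_on_iff_eq_0 by blast
qed

lemma image_coimage:
  assumes c: "op_chain H d" shows "d p ` coimage H d p = range_space H d p"
proof
  show "range_space H d p \<subseteq> d p ` coimage H d p"
    using coimage_decomposition[OF c] unfolding range_space_def by (metis image_eqI image_subsetI)
qed (auto simp: range_space_def coimage_def)

text \<open>
  On the vectors that \<open>d p\<close> maps into the null space the reduced map is \<open>d p\<close> itself, and the bijection
  \<open>d p\<close> from the coimage to the range carries their codimension to that of the intersection.
\<close>

lemma fredholm_index_reduced_map:
  assumes c: "op_chain H d"
    and N: "has_codim (null_space H d (p - 1)) (null_space H d (p - 1) \<inter> range_space H d p) b"
    and R: "has_codim (range_space H d p) (null_space H d (p - 1) \<inter> range_space H d p) a"
  shows "fredholm_index (reduced_map H d p) (coimage H d p) (null_space H d (p - 1)) (int a - int b)"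
proof -
  let ?N = "null_space H d (p - 1)" and ?R = "range_space H d p" and ?M = "coimage H d p"
  have ld: "lin (d p)" by (rule bop_lin[OF op_chainD(2)[OF c]])
  define X0 where "X0 = {x\<in>?M. d p x \<in> ?N \<inter> ?R}"
  have sM: "subspace ?M" using closed_subspace_coimage[OF c] by (simp add: closed_subspace_def)
  obtain m where m: "has_codim ?M X0 m"
    using has_codim_vimage[OF ld sM R] image_coimage[OF c] unfolding X0_def by blast
  have im: "d p ` X0 = ?N \<inter> ?R"
  proof
    show "?N \<inter> ?R \<subseteq> d p ` X0" using image_coimage[OF c, of p] by (auto simp: X0_def)
  qed (auto simp: X0_def)
  have "has_codim ?R (?N \<inter> ?R) m"
    using has_codim_image_inj[OF ld m inj_on_coimage[OF c]] by (simp add: im image_coimage[OF c])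
  then have "m = a" using R has_codim_unique by blast
  have eq: "reduced_map H d p x = d p x" if "x \<in> X0" for x
    using that proj_id[OF closed_subspace_null_space[OF c]] by (simp add: X0_def reduced_map_def)
  have im': "reduced_map H d p ` X0 = ?N \<inter> ?R" unfolding im[symmetric] by (rule image_cong[OF refl eq])
  have "inj_on (d p) X0" by (rule inj_on_subset[OF inj_on_coimage[OF c]]) (auto simp: X0_def)
  moreover have "inj_on (reduced_map H d p) X0 \<longleftrightarrow> inj_on (d p) X0" by (rule inj_on_cong) (rule eq)
  ultimately have "inj_on (reduced_map H d p) X0" by simp
  then have "index_on (reduced_map H d p) ?M ?N X0 (int a - int b)"
    unfolding index_on_def im' using m N \<open>m = a\<close> by blast
  moreover have "reduced_map H d p ` ?M \<subseteq> ?N"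
    using proj_mem[OF closed_subspace_null_space[OF c]] by (auto simp: reduced_map_def)
  ultimately show ?thesis unfolding fredholm_index_def using bop_lin[OF bop_reduced_map[OF c]] by blast
qed

text \<open>
  If \<open>d' p z = 0\<close>, the component \<open>w\<close> of \<open>z\<close> in the coimage of \<open>d p\<close> satisfies \<open>d p w = - \<kappa> z\<close>, and a parametrix
  \<open>E\<close> of the reduced map recovers \<open>w\<close> from \<open>- \<kappa> z\<close> up to a finite rank operator.
\<close>

lemma null_space_perturbation:
  assumes c: "op_chain H d" and c': "op_chain H d'"
    and \<kappa>: "approximable \<kappa>" "\<And>x. d' p x = d p x + \<kappa> x"
    and i: "fredholm_index (reduced_map H d p) (coimage H d p) (null_space H d (p - 1)) i"
  shows "\<exists>K. approximable K \<and> (\<forall>z\<in>null_space H d' p. z = proj (null_space H d p) z + K z)"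
proof -
  let ?N = "null_space H d p" and ?Q = "null_space H d (p - 1)"
  have cN: "closed_subspace ?N" "closed_subspace ?Q" using closed_subspace_null_space[OF c] by auto
  obtain E L where E: "bop E" and L: "approximable L"
    and ED: "\<And>x. x \<in> coimage H d p \<Longrightarrow> E (reduced_map H d p x) = x + L x"
    using fredholm_parametrix[OF i bop_reduced_map[OF c] closed_subspace_coimage[OF c] cN(2)] by blast
  interpret E: module_hom scale scale E by (rule bop_lin[OF E])
  interpret P0: module_hom scale scale "proj ?Q" by (rule lin_proj[OF cN(2)])
  define K where "K z = - (E (proj ?Q (\<kappa> z)) + L (z - proj ?N z))" for z
  have "approximable K" unfolding K_def
    by (rule approximable_minus[OF approximable_add[OF
          approximable_compose_left[OF approximable_compose_left[OF \<kappa>(1) bop_proj[OF cN(2)]] E]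
          approximable_compose_right[OF L bop_diff[OF bop_id bop_proj[OF cN(1)]]]]])
  moreover have "z = proj ?N z + K z" if z: "z \<in> null_space H d' p" for z
  proof -
    define w where "w = z - proj ?N z"
    have zH: "z \<in> H p" and dz: "d p z = - \<kappa> z" using z \<kappa>(2)[of z] by (auto simp: null_space_def eq_neg_iff_add_eq_0)
    have "w \<in> coimage H d p" "d p w = - \<kappa> z"
      using coimage_decomposition[OF c zH] dz by (auto simp: w_def)
    then have "w + L w = - E (proj ?Q (\<kappa> z))"
      using ED[of w] by (simp add: reduced_map_def P0.neg E.neg)
    then have "w = - (E (proj ?Q (\<kappa> z)) + L w)" by (metis add_diff_cancel_right' minus_add_distrib uminus_add_conv_diff diff_conv_add_uminus)
    then show ?thesis by (simp add: K_def w_def)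
  qed
  ultimately show ?thesis by blast
qed

text \<open>
  The part of \<open>d p\<close> that misses the next null space; it vanishes for a complex.
\<close>

definition defect :: "(int \<Rightarrow> 'a set) \<Rightarrow> (int \<Rightarrow> 'a \<Rightarrow> 'a) \<Rightarrow> int \<Rightarrow> 'a \<Rightarrow> 'a" where
  "defect H d p x = d p (proj (H p) x) - proj (null_space H d (p - 1)) (d p (proj (H p) x))"

text \<open>
  The defect factors through the quotient of the range by its intersection with the null space, so it has
  finite rank.
\<close>

lemma approximable_defect:
  assumes c: "op_chain H d"
    and R: "has_codim (range_space H d p) (null_space H d (p - 1) \<inter> range_space H d p) a"
  shows "approximable (defect H d p)"
proof (rule approximable_finite_rank)
  let ?N = "null_space H d (p - 1)" and ?R = "range_space H d p"
  have cN: "closed_subspace ?N" by (rule closed_subspace_null_space[OF c])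
  have lQ: "lin (\<lambda>x. x - proj ?N x)" by (rule lin_diff[OF lin_id lin_proj[OF cN]])
  have ldp: "lin (\<lambda>x. d p (proj (H p) x))"
    by (rule lin_compose[OF bop_lin[OF op_chainD(2)[OF c]] lin_proj[OF op_chainD(1)[OF c]]])
  show "lin (defect H d p)" unfolding defect_def using lin_compose[OF lQ ldp] .
  have "(\<lambda>x. x - proj ?N x) ` (?N \<inter> ?R) = {0}"
    using proj_id[OF cN] subspace_0[OF has_codim_subspace(2)[OF R]] by force
  then obtain m where "has_codim ((\<lambda>x. x - proj ?N x) ` ?R) {0} m"
    using has_codim_image[OF lQ R] by auto
  then have "finite_dim ((\<lambda>x. x - proj ?N x) ` ?R)" by (rule has_codim_0_finite_dim)
  moreover have "range (defect H d p) \<subseteq> (\<lambda>x. x - proj ?N x) ` ?R"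
    using proj_mem[OF op_chainD(1)[OF c]] by (auto simp: defect_def range_space_def)
  ultimately show "finite_dim (range (defect H d p))" by (rule finite_dim_mono)
qed

lemma defect_eq:
  assumes c: "op_chain H d" and x: "x \<in> H p"
  shows "d p x = reduced_map H d p x + defect H d p x"
  using proj_id[OF op_chainD(1)[OF c] x] by (simp add: defect_def reduced_map_def)

text \<open>
  With a parametrix \<open>E\<close> of the reduced map of \<open>d\<close> and the projection \<open>P\<close> onto its null space, \<open>S = E P\<close> is a right
  inverse of \<open>d' p\<close> on \<open>null_space H d' (p - 1)\<close> up to a compact operator. Compressed to this null space,
  \<open>d' p \<circ> S\<close> has a range of finite codimension, and where \<open>d' (p - 1) \<circ> d' p \<circ> S\<close> vanishes no compression
  takes place. The second claim restates that \<open>d' (p - 1)\<close> has finite rank on the range of \<open>d' p\<close>.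
\<close>

lemma fredholm_perturbation:
  assumes c: "op_chain H d" and c': "op_chain H d'"
    and \<kappa>: "\<And>p. approximable (\<kappa> p)" "\<And>p x. d' p x = d p x + \<kappa> p x"
    and i: "\<And>p. fredholm_index (reduced_map H d p) (coimage H d p) (null_space H d (p - 1)) (i p)"
    and R: "has_codim (range_space H d p) (null_space H d (p - 1) \<inter> range_space H d p) a"
    and fin: "finite_dim ((\<lambda>x. d' (p - 1) (d' p x)) ` H p)"
  shows "\<exists>b. has_codim (null_space H d' (p - 1)) (null_space H d' (p - 1) \<inter> range_space H d' p) b"
    and "\<exists>a. has_codim (range_space H d' p) (null_space H d' (p - 1) \<inter> range_space H d' p) a"
proof -
  let ?N = "null_space H d (p - 1)" and ?N' = "null_space H d' (p - 1)" and ?R' = "range_space H d' p"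
  have cN: "closed_subspace ?N" "closed_subspace ?N'" using closed_subspace_null_space c c' by auto
  have sN': "subspace ?N'" using cN by (simp add: closed_subspace_def)
  have sR': "subspace ?R'" by (rule subspace_range_space[OF c'])
  have ld': "lin (d' q)" for q by (rule bop_lin[OF op_chainD(2)[OF c']])
  have ld'd': "lin (\<lambda>x. d' (p - 1) (d' p x))" by (rule lin_compose[OF ld' ld'])
  have R'H: "?R' \<subseteq> H (p - 1)" using op_chainD(3)[OF c'] by (auto simp: range_space_def)
  have "finite_dim (d' (p - 1) ` ?R')" using fin by (simp add: range_space_def image_image)
  from has_codim_kernel[OF ld' sR' this]
  show "\<exists>a. has_codim ?R' (?N' \<inter> ?R') a"
  proof -
    have "{x \<in> ?R'. d' (p - 1) x = 0} = ?N' \<inter> ?R'" using R'H by (auto simp: null_space_def)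
    with \<open>\<exists>n. has_codim ?R' {x \<in> ?R'. d' (p - 1) x = 0} n\<close> show ?thesis by simp
  qed
  obtain E K1 where E: "bop E" "range E \<subseteq> coimage H d p" and K1: "approximable K1"
    and DE: "\<And>y. y \<in> ?N \<Longrightarrow> reduced_map H d p (E y) = y + K1 y"
    using fredholm_parametrix[OF i bop_reduced_map[OF c] closed_subspace_coimage[OF c] cN(1)] by blast
  have EH: "E y \<in> H p" for y using E(2) by (auto simp: coimage_def)
  obtain K where K: "approximable K" "\<And>z. z \<in> ?N' \<Longrightarrow> z = proj ?N z + K z"
    using null_space_perturbation[OF c c' \<kappa> i] by blast
  define S where "S z = E (proj ?N z)" for z
  have bS: "bop S" unfolding S_def by (rule bop_compose[OF E(1) bop_proj[OF cN(1)]])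
  have SH: "S z \<in> H p" for z using EH by (simp add: S_def)
  \<comment> \<open>collects the four errors: of \<open>proj\<close> on the perturbed null space, of the parametrix, of the range of \<open>d p\<close> outside the null space, and of replacing \<open>d p\<close> by \<open>d' p\<close>\<close>
  define K4 where "K4 z = (- K z + K1 (proj ?N z)) + (defect H d p (S z) + \<kappa> p (S z))" for z
  have aK4: "approximable K4" unfolding K4_def
    by (rule approximable_add[OF approximable_add[OF approximable_minus[OF K(1)] approximable_compose_right[OF K1 bop_proj[OF cN(1)]]]
          approximable_add[OF approximable_compose_right[OF approximable_defect[OF c R] bS] approximable_compose_right[OF \<kappa>(1) bS]]])
  have dS: "d' p (S z) = z + K4 z" if "z \<in> ?N'" for z
  proof -
    have "d' p (S z) = reduced_map H d p (S z) + defect H d p (S z) + \<kappa> p (S z)"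
      using \<kappa>(2) defect_eq[OF c SH] by simp
    also have "reduced_map H d p (S z) = proj ?N z + K1 (proj ?N z)"
      unfolding S_def by (rule DE[OF proj_mem[OF cN(1)]])
    also have "proj ?N z = z - K z" using K(2)[OF that] by (metis add_diff_cancel_right')
    finally show ?thesis by (simp add: K4_def \<open>proj ?N z = z - K z\<close>)
  qed
  interpret P': module_hom scale scale "proj ?N'" by (rule lin_proj[OF cN(2)])
  define T where "T z = proj ?N' (d' p (S z))" for z
  have lT: "lin T" unfolding T_def by (rule lin_compose[OF lin_proj[OF cN(2)] lin_compose[OF ld' bop_lin[OF bS]]])
  have "fredholm_index T ?N' ?N' 0"
  proof (rule fredholm_index_id_plus[OF cN(2) lT _ approximable_compose_left[OF aK4 bop_proj[OF cN(2)]]])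
    show "T ` ?N' \<subseteq> ?N'" using proj_mem[OF cN(2)] by (auto simp: T_def)
    show "T z = z + proj ?N' (K4 z)" if "z \<in> ?N'" for z
      by (simp add: T_def dS[OF that] P'.add proj_id[OF cN(2) that])
  qed
  then obtain X0 m n where X0: "has_codim ?N' X0 m" "has_codim ?N' (T ` X0) n"
    by (auto simp: fredholm_index_def index_on_def)
  \<comment> \<open>on \<open>Z0\<close> the vectors \<open>d' p (S z)\<close> already lie in the null space\<close>
  define Z0 where "Z0 = {z\<in>X0. d' (p - 1) (d' p (S z)) = 0}"
  have "(\<lambda>z. d' (p - 1) (d' p (S z))) ` X0 \<subseteq> (\<lambda>x. d' (p - 1) (d' p x)) ` H p" using SH by auto
  from finite_dim_mono[OF fin this]
  obtain k where k: "has_codim X0 Z0 k" unfolding Z0_def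
    using has_codim_kernel[OF lin_compose[OF ld'd' bop_lin[OF bS]] has_codim_subspace(2)[OF X0(1)]] by blast
  obtain l where l: "has_codim (T ` X0) (T ` Z0) l" using has_codim_image[OF lT k] by blast
  have codim: "has_codim ?N' (T ` Z0) (n + l)" by (rule has_codim_trans[OF X0(2) l])
  have sub: "T ` Z0 \<subseteq> ?N' \<inter> ?R'"
  proof
    fix y assume "y \<in> T ` Z0"
    then obtain z where z: "z \<in> Z0" "y = T z" by blast
    have N': "d' p (S z) \<in> ?N'" using z op_chainD(3)[OF c'] by (auto simp: Z0_def null_space_def)
    then have "y = d' p (S z)" using z proj_id[OF cN(2)] by (simp add: T_def)
    then show "y \<in> ?N' \<inter> ?R'" using N' SH by (auto simp: range_space_def)
  qed
  show "\<exists>b. has_codim ?N' (?N' \<inter> ?R') b"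
    using has_codim_between(1)[OF codim subspace_inter[OF sN' sR'] sub] by blast
qed

lemma null_space_projection_index:
  assumes c: "op_chain H d" and c': "op_chain H d'"
    and \<kappa>: "\<And>p. approximable (\<kappa> p)" "\<And>p x. d' p x = d p x + \<kappa> p x"
    and i: "fredholm_index (reduced_map H d p) (coimage H d p) (null_space H d (p - 1)) i"
    and i': "fredholm_index (reduced_map H d' p) (coimage H d' p) (null_space H d' (p - 1)) i'"
  shows "\<exists>a. fredholm_index (proj (null_space H d' p)) (null_space H d p) (null_space H d' p) a \<and>
    fredholm_index (proj (coimage H d' p)) (coimage H d p) (coimage H d' p) (- a)"
proof -
  obtain K where K: "approximable K" "\<And>z. z \<in> null_space H d' p \<Longrightarrow> z = proj (null_space H d p) z + K z"
    using null_space_perturbation[OF c c' \<kappa> i] by blast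
  have "approximable (\<lambda>x. - \<kappa> p x)" "\<And>x. d p x = d' p x + - \<kappa> p x"
    using approximable_minus[OF \<kappa>(1)] \<kappa>(2) by auto
  then obtain K' where K': "approximable K'" "\<And>z. z \<in> null_space H d p \<Longrightarrow> z = proj (null_space H d' p) z + K' z"
    using null_space_perturbation[OF c' c _ _ i'] by blast
  show ?thesis unfolding coimage_def
    by (rule projection_index[OF op_chainD(1)[OF c] closed_subspace_null_space[OF c] null_space_subset
          closed_subspace_null_space[OF c'] null_space_subset K K'])
qed

text \<open>
  Both ways around the square from the coimage of \<open>d\<close> in degree \<open>p\<close> to the null space of \<open>d'\<close> in degree \<open>p - 1\<close> give
  \<open>d\<close> followed by a projection, up to the perturbation \<open>\<kappa>\<close> and the defect.
\<close>

lemma reduced_map_index_difference: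
  assumes c: "op_chain H d" and c': "op_chain H d'"
    and \<kappa>: "\<And>p. approximable (\<kappa> p)" "\<And>p x. d' p x = d p x + \<kappa> p x"
    and i: "fredholm_index (reduced_map H d p) (coimage H d p) (null_space H d (p - 1)) i"
    and i': "fredholm_index (reduced_map H d' p) (coimage H d' p) (null_space H d' (p - 1)) i'"
    and R: "has_codim (range_space H d p) (null_space H d (p - 1) \<inter> range_space H d p) r"
    and b: "fredholm_index (proj (null_space H d' (p - 1))) (null_space H d (p - 1)) (null_space H d' (p - 1)) b"
    and a: "fredholm_index (proj (coimage H d' p)) (coimage H d p) (coimage H d' p) (- a)"
  shows "i + b = i' - a"
proof -
  let ?Q = "null_space H d (p - 1)" and ?Q' = "null_space H d' (p - 1)"
  let ?M = "coimage H d p" and ?M' = "coimage H d' p"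
  have cN0: "closed_subspace ?Q" "closed_subspace ?Q'" using closed_subspace_null_space c c' by auto
  interpret d': module_hom scale scale "d' p" by (rule bop_lin[OF op_chainD(2)[OF c']])
  interpret P0: module_hom scale scale "proj ?Q'" by (rule lin_proj[OF cN0(2)])
  have 1: "fredholm_index (proj ?Q' \<circ> reduced_map H d p) ?M ?Q' (i + b)"
    by (rule fredholm_index_compose[OF i b])
  have 2: "fredholm_index (reduced_map H d' p \<circ> proj ?M') ?M ?Q' (- a + i')"
    by (rule fredholm_index_compose[OF a i'])
  have bp: "bop (proj ?Q' \<circ> reduced_map H d p)"
    unfolding o_def by (rule bop_compose[OF bop_proj[OF cN0(2)] bop_reduced_map[OF c]])
  have K: "approximable (\<lambda>w. proj ?Q' (defect H d p w + \<kappa> p w))"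
    by (rule approximable_compose_left[OF approximable_add[OF approximable_defect[OF c R] \<kappa>(1)] bop_proj[OF cN0(2)]])
  have "i + b = - a + i'"
  proof (rule fredholm_index_perturbation[OF 1 bp 2 closed_subspace_coimage[OF c] cN0(2) K])
    fix w assume "w \<in> ?M"
    then have wH: "w \<in> H p" by (simp add: coimage_def)
    have "proj ?M' w = w - proj (null_space H d' p) w"
      unfolding coimage_def by (rule proj_complement[OF op_chainD(1)[OF c] closed_subspace_null_space[OF c'] null_space_subset wH])
    then have "d' p (proj ?M' w) = d' p w" using coimage_decomposition(2)[OF c' wH] by simp
    also have "\<dots> = reduced_map H d p w + (defect H d p w + \<kappa> p w)"
      using \<kappa>(2) defect_eq[OF c wH] by (simp add: add.assoc)
    finally show "(reduced_map H d' p \<circ> proj ?M') w = (proj ?Q' \<circ> reduced_map H d p) w + proj ?Q' (defect H d p w + \<kappa> p w)"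
      by (simp add: reduced_map_def[of H d'] P0.add)
  qed
  then show ?thesis by simp
qed

lemma fredholm_index_proj_same:
  assumes "closed_subspace N" shows "fredholm_index (proj N) N N 0"
proof (rule fredholm_index_id_plus[OF assms lin_proj[OF assms]])
  show "approximable (\<lambda>x. 0)"
    by (rule approximable_finite_rank) (auto simp: module_hom_iff module_axioms finite_dim_def)
qed (use proj_mem[OF assms] proj_id[OF assms] in auto)

lemma alternating_sum_telescope:
  "(\<Sum>p\<in>{0..int n}. (-1) ^ nat p * (a (p + 1) + a p)) = a 0 + (-1) ^ n * a (int n + 1)" for a :: "int \<Rightarrow> int"
proof -
  have "(\<Sum>p\<in>{0..int n}. (-1) ^ nat p * (a (p + 1) + a p)) = (\<Sum>p\<in>{0..n}. (-1) ^ p * (a (int p + 1) + a (int p)))"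
    using sum.reindex[of int "{0..n}" "\<lambda>p. (-1) ^ nat p * (a (p + 1) + a p)"]
    by (simp add: image_int_atLeastAtMost)
  also have "\<dots> = a 0 + (-1) ^ n * a (int n + 1)"
    by (induction n) (simp_all add: algebra_simps)
  finally show ?thesis .
qed

section \<open>Compact perturbations of Fredholm chains\<close>

lemma bop_extension:
  assumes X: "closed_subspace X" and T: "bounded_op X Y T"
  shows "bop (\<lambda>x. T (proj X x))"
proof -
  interpret P: module_hom scale scale "proj X" by (rule lin_proj[OF X])
  obtain C where C: "\<And>x. x \<in> X \<Longrightarrow> norm (T x) \<le> C * norm x" using T unfolding bounded_op_def by blast
  have add: "T (x + y) = T x + T y" if "x \<in> X" "y \<in> X" for x y using T that by (simp add: bounded_op_def)
  have sc: "T (scale c x) = scale c (T x)" if "x \<in> X" for c x using T that by (simp add: bounded_op_def)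
  have "norm (T (proj X x)) \<le> \<bar>C\<bar> * norm x" for x
  proof -
    have "norm (T (proj X x)) \<le> C * norm (proj X x)" by (rule C[OF proj_mem[OF X]])
    also have "\<dots> \<le> \<bar>C\<bar> * norm (proj X x)" by (intro mult_right_mono) auto
    also have "\<dots> \<le> \<bar>C\<bar> * norm x" by (intro mult_left_mono norm_proj[OF X]) auto
    finally show ?thesis .
  qed
  moreover have "lin (\<lambda>x. T (proj X x))"
    by (auto simp: module_hom_iff module_axioms P.add P.scale add sc proj_mem[OF X])
  ultimately show ?thesis unfolding bop_def by blast
qed

lemma approximable_extension:
  assumes X: "closed_subspace X" and T: "compact_op X Y T"
  shows "approximable (\<lambda>x. T (proj X x))"
proof (rule approximable_compact)
  show "lin (\<lambda>x. T (proj X x))"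
    using bop_lin[OF bop_extension[OF X]] T by (auto simp: compact_op_def)
  have "proj X ` cball 0 1 = X \<inter> cball 0 1"
  proof
    show "proj X ` cball 0 1 \<subseteq> X \<inter> cball 0 1"
      using proj_mem[OF X] order.trans[OF norm_proj(1)[OF X]] by auto
    show "X \<inter> cball 0 1 \<subseteq> proj X ` cball 0 1" using proj_id[OF X] by force
  qed
  then have "(\<lambda>x. T (proj X x)) ` cball 0 1 = T ` (X \<inter> cball 0 1)" by (metis image_image)
  then show "compact (closure ((\<lambda>x. T (proj X x)) ` cball 0 1))" using T by (simp add: compact_op_def)
qed

lemma bounded_op_add:
  assumes "bounded_op X Y S" "bounded_op X Y T" "subspace Y" "\<And>x. x \<in> X \<Longrightarrow> R x = S x + T x" "subspace X"
  shows "bounded_op X Y R"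
proof -
  obtain C where C: "\<And>x. x \<in> X \<Longrightarrow> norm (S x) \<le> C * norm x" using assms(1) unfolding bounded_op_def by blast
  obtain D where D: "\<And>x. x \<in> X \<Longrightarrow> norm (T x) \<le> D * norm x" using assms(2) unfolding bounded_op_def by blast
  have "norm (R x) \<le> (C + D) * norm x" if "x \<in> X" for x
    using norm_triangle_ineq[of "S x" "T x"] C[OF that] D[OF that] assms(4)[OF that] by (simp add: algebra_simps)
  then show ?thesis using assms unfolding bounded_op_def
    by (auto simp: subspace_add subspace_scale scale_right_distrib)
qed

text \<open>
  The Fredholm condition in all degrees, including those where the spaces vanish, so that
  statements about neighbouring degrees need no case distinction.
\<close>

definition fredholm_everywhere :: "(int \<Rightarrow> 'a set) \<Rightarrow> (int \<Rightarrow> 'a \<Rightarrow> 'a) \<Rightarrow> bool" where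
  "fredholm_everywhere H d \<longleftrightarrow> (\<forall>p.
     (\<exists>b. has_codim (null_space H d (p - 1)) (null_space H d (p - 1) \<inter> range_space H d p) b) \<and>
     (\<exists>a. has_codim (range_space H d p) (null_space H d (p - 1) \<inter> range_space H d p) a))"

text \<open>
  The sign makes this the index of the reduced map out of degree \<open>p\<close>, hence the opposite of the
  contribution of degree \<open>p - 1\<close> to the index of the chain, apart from the alternating sign.
\<close>

definition reduced_index :: "(int \<Rightarrow> 'a set) \<Rightarrow> (int \<Rightarrow> 'a \<Rightarrow> 'a) \<Rightarrow> int \<Rightarrow> int" where
  "reduced_index H d p =
     int (quot_dim (range_space H d p) (null_space H d (p - 1) \<inter> range_space H d p)) -
     int (quot_dim (null_space H d (p - 1)) (null_space H d (p - 1) \<inter> range_space H d p))"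

lemma fredholm_index_reduced_index:
  assumes "op_chain H d" "fredholm_everywhere H d"
  shows "fredholm_index (reduced_map H d p) (coimage H d p) (null_space H d (p - 1)) (reduced_index H d p)"
proof -
  obtain a b where "has_codim (null_space H d (p - 1)) (null_space H d (p - 1) \<inter> range_space H d p) b"
    "has_codim (range_space H d p) (null_space H d (p - 1) \<inter> range_space H d p) a"
    using assms(2) unfolding fredholm_everywhere_def by blast
  then show ?thesis
    using fredholm_index_reduced_map[OF assms(1)] has_codim_quot_dim unfolding reduced_index_def by metis
qed

lemma chain_index_reduced_index:
  "chain_index n H d = - (\<Sum>p\<in>{0..int n}. (-1) ^ nat p * reduced_index H d (p + 1))"
  unfolding chain_index_def reduced_index_def sum_negf[symmetric]
  by (rule sum.cong) (simp_all add: right_diff_distrib)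

lemma fredholm_everywhere_perturbation:
  assumes c: "op_chain H d" "op_chain H d'" "fredholm_everywhere H d"
    and \<kappa>: "\<And>p. approximable (\<kappa> p)" "\<And>p x. d' p x = d p x + \<kappa> p x"
    and fin: "\<And>p. finite_dim ((\<lambda>x. d' (p - 1) (d' p x)) ` H p)"
  shows "fredholm_everywhere H d'"
  unfolding fredholm_everywhere_def
proof (intro allI)
  fix p
  obtain a where a: "has_codim (range_space H d p) (null_space H d (p - 1) \<inter> range_space H d p) a"
    using c(3) unfolding fredholm_everywhere_def by blast
  show "(\<exists>b. has_codim (null_space H d' (p - 1)) (null_space H d' (p - 1) \<inter> range_space H d' p) b) \<and>
     (\<exists>a. has_codim (range_space H d' p) (null_space H d' (p - 1) \<inter> range_space H d' p) a)"
    using fredholm_perturbation[where \<kappa> = \<kappa> and i = "reduced_index H d" and a = a and p = p,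
        OF c(1,2) \<kappa> fredholm_index_reduced_index[OF c(1,3)] a fin[of p]] by (rule conjI)
qed

text \<open>
  The indices \<open>a p\<close> of the projections between the null spaces satisfy
  \<open>reduced_index H d' (p + 1) - reduced_index H d (p + 1) = a (p + 1) + a p\<close>, so the difference of the two alternating
  sums telescopes to boundary terms, and there the null spaces coincide.
\<close>

lemma chain_index_perturbation:
  assumes c: "op_chain H d" "op_chain H d'" "fredholm_everywhere H d" "fredholm_everywhere H d'"
    and \<kappa>: "\<And>p. approximable (\<kappa> p)" "\<And>p x. d' p x = d p x + \<kappa> p x"
    and ends: "H (- 1) = {0}" "H (int n + 1) = {0}"
  shows "chain_index n H d = chain_index n H d'"
proof -
  note i = fredholm_index_reduced_index[OF c(1,3)]
  note i' = fredholm_index_reduced_index[OF c(2,4)]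
  have "\<forall>p. \<exists>a. fredholm_index (proj (null_space H d' p)) (null_space H d p) (null_space H d' p) a \<and>
    fredholm_index (proj (coimage H d' p)) (coimage H d p) (coimage H d' p) (- a)"
    using null_space_projection_index[OF c(1,2) \<kappa> i i'] by blast
  then obtain a where a: "\<And>p. fredholm_index (proj (null_space H d' p)) (null_space H d p) (null_space H d' p) (a p)"
    "\<And>p. fredholm_index (proj (coimage H d' p)) (coimage H d p) (coimage H d' p) (- a p)" by metis
  have diff: "reduced_index H d p + a (p - 1) = reduced_index H d' p - a p" for p
  proof -
    obtain r where r: "has_codim (range_space H d p) (null_space H d (p - 1) \<inter> range_space H d p) r"
      using c(3) unfolding fredholm_everywhere_def by blast
    show ?thesis by (rule reduced_map_index_difference[OF c(1,2) \<kappa> i i' r a(1) a(2)])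
  qed
  have same: "a p = 0" if "null_space H d p = null_space H d' p" for p
    by (rule fredholm_index_unique[OF a(1)[of p, unfolded that]
          fredholm_index_proj_same[OF closed_subspace_null_space[OF c(2)]]])
  have "d 0 x = 0" "d' 0 x = 0" for x using op_chainD(3)[OF c(1), of 0 x] op_chainD(3)[OF c(2), of 0 x] ends by auto
  then have a0: "a 0 = 0" by (intro same) (simp add: null_space_def)
  have "null_space H e (int n + 1) = {0}" if e: "op_chain H e" for e
  proof -
    have "subspace (null_space H e (int n + 1))"
      using closed_subspace_null_space[OF e] by (simp add: closed_subspace_def)
    from subspace_0[OF this] show ?thesis using null_space_subset[of H e "int n + 1"] ends by auto
  qed
  then have an: "a (int n + 1) = 0" using c by (intro same) simp
  have "reduced_index H d' (p + 1) = reduced_index H d (p + 1) + (a (p + 1) + a p)" for p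
    using diff[of "p + 1"] by simp
  then have "(\<Sum>p\<in>{0..int n}. (-1) ^ nat p * reduced_index H d' (p + 1)) =
    (\<Sum>p\<in>{0..int n}. (-1) ^ nat p * reduced_index H d (p + 1)) + (\<Sum>p\<in>{0..int n}. (-1) ^ nat p * (a (p + 1) + a p))"
    by (simp add: distrib_left sum.distrib)
  then show ?thesis
    unfolding chain_index_reduced_index alternating_sum_telescope a0 an by simp
qed

text \<open>
  Outside the degrees from 0 to \<open>n\<close> the null space and the range that meet in degree \<open>p\<close> are both 0.
\<close>

lemma fredholm_chain_iff_everywhere:
  assumes s: "spaces_and_maps n H d" and c: "op_chain H e"
    and eq: "\<And>p. null_space H e p = null_space H d p" "\<And>p. range_space H e p = range_space H d p"
  shows "fredholm_chain n H d \<longleftrightarrow> fredholm_everywhere H e"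
proof -
  let ?P = "\<lambda>p. quot_finite_dim (null_space H d p) (null_space H d p \<inter> range_space H d (p + 1)) \<and>
        quot_finite_dim (range_space H d (p + 1)) (null_space H d p \<inter> range_space H d (p + 1))"
  have sN: "subspace (null_space H d p)" for p
    using closed_subspace_null_space[OF c, of p] by (simp add: eq closed_subspace_def)
  have sR: "subspace (range_space H d p)" for p
    using subspace_range_space[OF c, of p] by (simp add: eq)
  have P: "?P p \<longleftrightarrow> (\<exists>b. has_codim (null_space H d p) (null_space H d p \<inter> range_space H d (p + 1)) b) \<and>
     (\<exists>a. has_codim (range_space H d (p + 1)) (null_space H d p \<inter> range_space H d (p + 1)) a)" for p
    using quot_finite_dim_has_codim[OF sN subspace_inter[OF sN sR]] quot_finite_dim_has_codim[OF sR subspace_inter[OF sN sR]]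
    by simp
  have triv: "?P p" if "p \<notin> {0..int n}" for p
  proof -
    have "H p = {0}" using s that by (auto simp: spaces_and_maps_def)
    then have "null_space H d p \<subseteq> {0}" "range_space H e (p + 1) \<subseteq> {0}"
      using op_chainD(3)[OF c, of "p + 1"] by (auto simp: null_space_def range_space_def)
    then have "null_space H d p = {0}" "range_space H d (p + 1) = {0}"
      using subspace_0[OF sN[of p]] subspace_0[OF sR[of "p + 1"]] unfolding eq by auto
    then show ?thesis unfolding P using has_codim_refl[OF subspace_single_0] by auto
  qed
  have "fredholm_everywhere H e \<longleftrightarrow> (\<forall>p. ?P (p - 1))"
    unfolding fredholm_everywhere_def eq P by simp
  also have "\<dots> \<longleftrightarrow> (\<forall>p. ?P p)" by (metis add_diff_cancel_right')
  also have "\<dots> \<longleftrightarrow> (\<forall>p\<in>{0..int n}. ?P p)" using triv by blast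
  finally show ?thesis unfolding fredholm_chain_def using s by simp
qed

lemma op_chain_extension:
  assumes s: "spaces_and_maps n H d"
  defines "e \<equiv> (\<lambda>p x. d p (proj (H p) x))"
  shows "op_chain H e" "null_space H e p = null_space H d p" "range_space H e p = range_space H d p"
proof -
  have cs: "closed_subspace (H p)" and bd: "bounded_op (H p) (H (p - 1)) (d p)" for p
    using s by (auto simp: spaces_and_maps_def)
  show "op_chain H e" unfolding op_chain_def e_def
    using cs bop_extension[OF cs bd] bd proj_mem[OF cs] by (auto simp: bounded_op_def)
  show "null_space H e p = null_space H d p" "range_space H e p = range_space H d p"
    unfolding null_space_def range_space_def e_def using proj_id[OF cs] by (auto intro!: image_cong)
qed

theorem fredholm_chain_compact_perturbation:
  assumes F: "fredholm_chain n H d"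
    and k: "\<And>p. compact_op (H p) (H (p - 1)) (k p)"
    and d': "\<And>p x. d' p x = d p x + k p x"
    and fin: "\<And>p. finite_dim ((d' p \<circ> d' (p + 1)) ` H (p + 1))"
  shows "fredholm_chain n H d'" "chain_index n H d = chain_index n H d'"
proof -
  have s: "spaces_and_maps n H d" using F by (simp add: fredholm_chain_def)
  have cs: "closed_subspace (H p)" and bd: "bounded_op (H p) (H (p - 1)) (d p)"
    and H0: "p < 0 \<or> p \<ge> int n + 1 \<Longrightarrow> H p = {0}" for p
    using s by (auto simp: spaces_and_maps_def)
  have bk: "bounded_op (H p) (H (p - 1)) (k p)" for p using k by (simp add: compact_op_def)
  have bd': "bounded_op (H p) (H (p - 1)) (d' p)" for p
    by (rule bounded_op_add[OF bd bk]) (use d' cs in \<open>auto simp: closed_subspace_def\<close>)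
  have "d' p 0 = 0" for p
  proof -
    have "0 \<in> H p" using cs subspace_0 by (auto simp: closed_subspace_def)
    then have "d' p (scale 0 0) = scale 0 (d' p 0)" using bd'[of p] unfolding bounded_op_def by blast
    then show ?thesis by simp
  qed
  then have s': "spaces_and_maps n H d'"
    unfolding spaces_and_maps_def using cs bd' H0 by auto
  define e where "e = (\<lambda>p x. d p (proj (H p) x))"
  define e' where "e' = (\<lambda>p x. d' p (proj (H p) x))"
  define \<kappa> where "\<kappa> = (\<lambda>p x. k p (proj (H p) x))"
  note e = op_chain_extension[OF s, folded e_def] and e' = op_chain_extension[OF s', folded e'_def]
  have \<kappa>: "approximable (\<kappa> p)" "e' p x = e p x + \<kappa> p x" for p x
    using approximable_extension[OF cs k] d' by (auto simp: \<kappa>_def e_def e'_def)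
  have Fe: "fredholm_everywhere H e" using fredholm_chain_iff_everywhere[OF s e] F by simp
  have "e' (p - 1) (e' p x) = d' (p - 1) (d' p x)" if "x \<in> H p" for p x
    using that proj_id[OF cs] bd'[of p] by (simp add: e'_def bounded_op_def)
  then have fin': "finite_dim ((\<lambda>x. e' (p - 1) (e' p x)) ` H p)" for p
    using fin[of "p - 1"] by (simp add: o_def)
  have Fe': "fredholm_everywhere H e'"
    by (rule fredholm_everywhere_perturbation[OF e(1) e'(1) Fe \<kappa> fin'])
  then show "fredholm_chain n H d'" using fredholm_chain_iff_everywhere[OF s' e'] by simp
  have "chain_index n H e = chain_index n H e'"
    by (rule chain_index_perturbation[OF e(1) e'(1) Fe Fe' \<kappa>]) (use H0 in auto)
  then show "chain_index n H d = chain_index n H d'"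
    unfolding chain_index_def e e' .
qed

end

theorem theorem6p6:
  fixes scale :: "'k::hilbert_scalar \<Rightarrow> 'a::{real_inner, complete_space} \<Rightarrow> 'a"
    and ip :: "'a \<Rightarrow> 'a \<Rightarrow> 'k"
    and n :: nat
    and H :: "int \<Rightarrow> 'a set"
    and \<delta> k \<delta>' :: "int \<Rightarrow> 'a \<Rightarrow> 'a"
  assumes "hilbert_space scale ip"
    and "hilbert_space.fredholm_chain scale n H \<delta>"
    and "\<And>p. hilbert_space.compact_op scale (H p) (H (p - 1)) (k p)"
    and "\<And>p x. \<delta>' p x = \<delta> p x + k p x"
    and "\<And>p. hilbert_space.finite_dim scale ((\<delta>' p \<circ> \<delta>' (p + 1)) ` H (p + 1))"
  shows "hilbert_space.fredholm_chain scale n H \<delta>' \<and>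
         hilbert_space.chain_index scale n H \<delta> = hilbert_space.chain_index scale n H \<delta>'"
proof -
  interpret hilbert_space scale ip by fact
  show ?thesis using fredholm_chain_compact_perturbation[OF assms(2-5)] by blast
qed

end
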